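(* Let $G$ be an infinite group and suppose there exists an epimorphism $\psi\colon G\to\mathbb{Z}$ such that $\psi(Z(G))=\mathbb{Z}$. For every integer $n\geq 2$ and all positive integers $k,\ell$, we have $\operatorname{Aut}(\{1,\dots,n^k\}^G)\cong\operatorname{Aut}(\{1,\dots,n^{\ell}\}^G)$ (as abstract groups) if and only if $k=\ell$.
   Context: For a finite set $A$ and a group $G$, the full shift $A^G=\{x\colon G\to A\}$ carries the prodiscrete topology and the left shift action $(gx)(h)=x(g^{-1}h)$. $\operatorname{Aut}(A^G)$ is the group of all $G$-equivariant homeomorphisms $A^G\to A^G$ under composition. $Z(G)$ is the center of $G$. *)

theory Defs
  imports
    "HOL-Algebra.Elementary_Groups"
    "HOL-Algebra.Bij"
    "HOL-Analysis.Function_Topology"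
begin

definition group_center :: "('g, 'm) monoid_scheme \<Rightarrow> 'g set" where
  "group_center G =
    {z \<in> carrier G. \<forall>g\<in>carrier G. z \<otimes>\<^bsub>G\<^esub> g = g \<otimes>\<^bsub>G\<^esub> z}"

(* The points are the extensional functions carrier G \<rightarrow>\<^sub>E A. *)
definition full_shift :: "('g, 'm) monoid_scheme \<Rightarrow> 'a set \<Rightarrow> ('g \<Rightarrow> 'a) topology" where
  "full_shift G A = product_topology (\<lambda>_. discrete_topology A) (carrier G)"

definition shift :: "('g, 'm) monoid_scheme \<Rightarrow> 'g \<Rightarrow> ('g \<Rightarrow> 'a) \<Rightarrow> 'g \<Rightarrow> 'a" where
  "shift G g x = (\<lambda>h\<in>carrier G. x (inv\<^bsub>G\<^esub> g \<otimes>\<^bsub>G\<^esub> h))"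

(* Membership in Bij makes the maps extensional, so that equality of functions is equality of
   maps on the full shift and composition is that of BijGroup. *)
definition shift_auts ::
    "('g, 'm) monoid_scheme \<Rightarrow> 'a set \<Rightarrow> (('g \<Rightarrow> 'a) \<Rightarrow> ('g \<Rightarrow> 'a)) set" where
  "shift_auts G A =
    {f \<in> Bij (topspace (full_shift G A)).
      homeomorphic_map (full_shift G A) (full_shift G A) f \<and>
      (\<forall>g\<in>carrier G. \<forall>x\<in>topspace (full_shift G A). f (shift G g x) = shift G g (f x))}"

definition shift_Aut ::
    "('g, 'm) monoid_scheme \<Rightarrow> 'a set \<Rightarrow> (('g \<Rightarrow> 'a) \<Rightarrow> ('g \<Rightarrow> 'a)) monoid" where
  "shift_Aut G A = BijGroup (topspace (full_shift G A)) \<lparr>carrier := shift_auts G A\<rparr>"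

lemma topspace_full_shift [simp]: "topspace (full_shift G A) = carrier G \<rightarrow>\<^sub>E A"
  by (simp add: full_shift_def)

lemma (in group) shift_in_full_shift:
  assumes "g \<in> carrier G" "x \<in> carrier G \<rightarrow>\<^sub>E A"
  shows "shift G g x \<in> carrier G \<rightarrow>\<^sub>E A"
  using assms by (auto simp: shift_def PiE_iff)

lemma (in group) shift_mult:
  assumes "g \<in> carrier G" "g' \<in> carrier G"
  shows "shift G (g \<otimes> g') x = shift G g (shift G g' x)"
  using assms by (auto simp: shift_def fun_eq_iff inv_mult_group m_assoc)

lemma (in group) shift_one:
  assumes "x \<in> carrier G \<rightarrow>\<^sub>E A"
  shows "shift G \<one> x = x"
  using assms by (auto simp: shift_def fun_eq_iff PiE_iff extensional_def)

lemma (in group) subgroup_shift_auts: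
  "subgroup (shift_auts G A) (BijGroup (carrier G \<rightarrow>\<^sub>E A))"
proof (rule group.subgroupI[OF group_BijGroup])
  let ?S = "carrier G \<rightarrow>\<^sub>E A"
  let ?X = "full_shift G A"
  show "shift_auts G A \<subseteq> carrier (BijGroup ?S)"
    by (auto simp: shift_auts_def BijGroup_def)
  have hid: "homeomorphic_map ?X ?X (\<lambda>x\<in>?S. x)"
    by (rule homeomorphic_map_eq[where f = id]) auto
  have "(\<lambda>x\<in>?S. x) \<in> shift_auts G A"
    using hid by (auto simp: shift_auts_def id_Bij shift_in_full_shift)
  then show "shift_auts G A \<noteq> {}" by blast
  fix f assume f: "f \<in> shift_auts G A"
  then have fB: "f \<in> Bij ?S" by (simp add: shift_auts_def)
  have inv_eq: "inv\<^bsub>BijGroup ?S\<^esub> f = restrict (inv_into ?S f) ?S"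
    using fB by (rule inv_BijGroup)
  have bij: "bij_betw f ?S ?S" using fB by (simp add: Bij_def)
  obtain h where h: "homeomorphic_maps ?X ?X f h"
    using f unfolding shift_auts_def homeomorphic_map_maps by blast
  have h_eq: "h y = restrict (inv_into ?S f) ?S y" if "y \<in> ?S" for y
  proof -
    have "continuous_map ?X ?X h" "\<forall>y\<in>topspace ?X. f (h y) = y"
      using h unfolding homeomorphic_maps_def by blast+
    then have "h y \<in> ?S" "f (h y) = y"
      using that unfolding continuous_map_def topspace_full_shift by blast+
    then show ?thesis
      using that inv_into_f_eq[OF bij_betw_imp_inj_on[OF bij]] by simp
  qed
  have "homeomorphic_map ?X ?X h"
    using h homeomorphic_maps_map by blast
  then have "homeomorphic_map ?X ?X (restrict (inv_into ?S f) ?S)"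
    by (rule homeomorphic_map_eq) (simp only: topspace_full_shift h_eq)
  moreover have "inv_into ?S f (shift G g x) = shift G g (inv_into ?S f x)"
    if g: "g \<in> carrier G" and x: "x \<in> ?S" for g x
  proof -
    have y: "inv_into ?S f x \<in> ?S" "f (inv_into ?S f x) = x"
      using bij x by (simp_all only: bij_betw_def inv_into_into f_inv_into_f)
    then have "f (shift G g (inv_into ?S f x)) = shift G g x"
      using f g unfolding shift_auts_def topspace_full_shift by simp
    moreover have "shift G g (inv_into ?S f x) \<in> ?S"
      using shift_in_full_shift[OF g y(1)] .
    ultimately show ?thesis
      using inv_into_f_eq[OF bij_betw_imp_inj_on[OF bij]] by blast
  qed
  ultimately show "inv\<^bsub>BijGroup ?S\<^esub> f \<in> shift_auts G A"
    using restrict_inv_into_Bij[OF fB]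
    by (simp add: shift_auts_def inv_eq shift_in_full_shift)
next
  fix f f'
  let ?S = "carrier G \<rightarrow>\<^sub>E A"
  let ?X = "full_shift G A"
  assume f: "f \<in> shift_auts G A" and f': "f' \<in> shift_auts G A"
  have B: "f \<in> Bij ?S" "f' \<in> Bij ?S" using f f' by (simp_all add: shift_auts_def)
  have f'S: "f' x \<in> ?S" if "x \<in> ?S" for x
    using that Bij_imp_funcset[OF B(2)] by blast
  have "homeomorphic_map ?X ?X (f \<circ> f')"
    using f f' by (auto simp: shift_auts_def intro: homeomorphic_map_compose)
  then have "homeomorphic_map ?X ?X (compose ?S f f')"
    by (rule homeomorphic_map_eq) (simp add: compose_eq)
  moreover have "compose ?S f f' (shift G g x) = shift G g (compose ?S f f' x)"
    if "g \<in> carrier G" "x \<in> ?S" for g x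
    using f f' f'S that shift_in_full_shift[OF that] by (simp add: shift_auts_def compose_eq)
  ultimately show "f \<otimes>\<^bsub>BijGroup ?S\<^esub> f' \<in> shift_auts G A"
    using compose_Bij[OF B] B by (simp add: shift_auts_def BijGroup_def)
qed

lemma (in group) group_shift_Aut: "group (shift_Aut G A)"
  unfolding shift_Aut_def topspace_full_shift
  by (rule subgroup.subgroup_is_group[OF subgroup_shift_auts group_BijGroup])

end

theory Submission
  imports Defs "HOL-Analysis.T1_Spaces" "HOL-Computational_Algebra.Nth_Powers"
begin

text \<open>The distinguishing invariant of the group \<open>Aut(A\<^sup>G)\<close> is the set of \<open>d\<close> such that every central
  element has a \<open>d\<close>-th root; it is the set of \<open>d\<close> for which \<open>|A|\<close> is a \<open>d\<close>-th power.

  By a version of Ryan's theorem, the central elements are the shifts by \<open>Z(G)\<close>: a central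
  automorphism commutes with a marker automorphism, which flips one symbol inside a pattern \<open>p\<close>, and
  if \<open>p\<close> contains enough local patterns, this forces the automorphism to be a central shift. If
  \<open>A = B\<^sup>d\<close>, the \<open>d\<close> digits of the symbols can be moved by one position at a time, which gives a
  \<open>d\<close>-th root of any central shift. Conversely, choose \<open>z\<close> in \<open>Z(G)\<close> with \<open>\<psi> z = 1\<close>. A \<open>d\<close>-th root of
  the shift by \<open>z\<close> acts on the configurations fixed by the kernel of \<open>\<psi>\<close>, that is on \<open>A\<close>-valued
  sequences over the integers. It multiplies the normalised volume of the set of sequences with a
  given past by a rational number whose \<open>d\<close>-th power is \<open>1/|A|\<close>, so \<open>|A|\<close> is a \<open>d\<close>-th power.\<close>

section \<open>Roots of the shift on sequences over the integers\<close>

abbreviation sequences :: "'a set \<Rightarrow> (int \<Rightarrow> 'a) set" where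
  "sequences A \<equiv> {x. \<forall>i. x i \<in> A}"

section \<open>Prefix counts for sets of sequences with a prescribed past\<close>

definition prefixes :: "int \<Rightarrow> (int \<Rightarrow> 'a) set \<Rightarrow> (int \<Rightarrow> 'a) set" where
  "prefixes R S = (\<lambda>y. restrict y {..<R}) ` S"

definition same_past :: "'a set \<Rightarrow> int \<Rightarrow> (int \<Rightarrow> 'a) \<Rightarrow> (int \<Rightarrow> 'a) set" where
  "same_past A m x = {y \<in> sequences A. \<forall>i<m. y i = x i}"

text \<open>For a set of sequences this says that it is a union of classes
  \<open>same_past A R y\<close>, so that membership is decided by the positions below
  \<open>R\<close>.\<close>

definition saturated :: "'a set \<Rightarrow> int \<Rightarrow> (int \<Rightarrow> 'a) set \<Rightarrow> bool" where
  "saturated A R S \<longleftrightarrow> (\<forall>y\<in>S. same_past A R y \<subseteq> S)"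

definition right_shift :: "(int \<Rightarrow> 'a) \<Rightarrow> int \<Rightarrow> 'a" where
  "right_shift x = (\<lambda>i. x (i - 1))"

definition has_radius :: "'a set \<Rightarrow> int \<Rightarrow> ((int \<Rightarrow> 'a) \<Rightarrow> int \<Rightarrow> 'a) \<Rightarrow> bool" where
  "has_radius A r T \<longleftrightarrow> (\<forall>x\<in>sequences A. \<forall>y\<in>sequences A. \<forall>i.
     (\<forall>j. \<bar>j - i\<bar> \<le> r \<longrightarrow> x j = y j) \<longrightarrow> T x i = T y i)"

lemma has_radiusD:
  assumes "has_radius A r T" "x \<in> sequences A" "y \<in> sequences A"
    and "\<And>j. \<bar>j - i\<bar> \<le> r \<Longrightarrow> x j = y j"
  shows "T x i = T y i"
  using assms unfolding has_radius_def by blast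

lemma restrict_lessThan_eq_iff:
  "restrict y {..<R} = restrict y' {..<R} \<longleftrightarrow> (\<forall>i<R. y i = y' i)" for R :: int
  by (auto simp: fun_eq_iff restrict_def)

lemma prefixesE:
  assumes "t \<in> prefixes R S"
  obtains y where "y \<in> S" "t = restrict y {..<R}"
  using assms unfolding prefixes_def by (elim imageE)

text \<open>Lets a count over a saturated set be split into counts over full classes, one for each
  prefix.\<close>

lemma prefix_class_eq:
  assumes "saturated A m S" "S \<subseteq> sequences A" "y \<in> S"
  shows "{w \<in> S. restrict w {..<m} = restrict y {..<m}} = same_past A m y"
proof
  show "{w \<in> S. restrict w {..<m} = restrict y {..<m}} \<subseteq> same_past A m y"
    using assms(2) by (auto simp: same_past_def restrict_lessThan_eq_iff)
  have "same_past A m y \<subseteq> S" using assms(1,3) by (simp add: saturated_def)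
  then show "same_past A m y \<subseteq> {w \<in> S. restrict w {..<m} = restrict y {..<m}}"
    by (auto simp: same_past_def restrict_lessThan_eq_iff)
qed

lemma card_prefixes_same_past:
  assumes A: "finite A" and x: "x \<in> sequences A" and mR: "m \<le> R"
  shows "card (prefixes R (same_past A m x)) = card A ^ nat (R - m)"
proof -
  have "bij_betw (\<lambda>y. restrict y {m..<R}) (prefixes R (same_past A m x)) ({m..<R} \<rightarrow>\<^sub>E A)"
  proof (rule bij_betw_byWitness[where f' = "\<lambda>v. \<lambda>i\<in>{..<R}. if i < m then x i else v i"])
    show "\<forall>a\<in>prefixes R (same_past A m x).
        (\<lambda>i\<in>{..<R}. if i < m then x i else restrict a {m..<R} i) = a"
      by (auto simp: prefixes_def same_past_def fun_eq_iff)
    show "\<forall>a'\<in>{m..<R} \<rightarrow>\<^sub>E A. restrict (\<lambda>i\<in>{..<R}. if i < m then x i else a' i) {m..<R} = a'"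
      by (auto simp: fun_eq_iff PiE_iff extensional_def)
    show "(\<lambda>y. restrict y {m..<R}) ` prefixes R (same_past A m x) \<subseteq> {m..<R} \<rightarrow>\<^sub>E A"
      by (auto simp: prefixes_def same_past_def)
    show "(\<lambda>v. \<lambda>i\<in>{..<R}. if i < m then x i else v i) ` ({m..<R} \<rightarrow>\<^sub>E A)
        \<subseteq> prefixes R (same_past A m x)"
    proof (safe, goal_cases)
      case (1 _ v)
      define y where "y = (\<lambda>i. if i < R \<and> m \<le> i then v i else x i)"
      have "y \<in> same_past A m x"
        using x 1 by (auto simp: same_past_def y_def PiE_iff)
      moreover have "restrict y {..<R} = (\<lambda>i\<in>{..<R}. if i < m then x i else v i)"
        by (auto simp: y_def fun_eq_iff)
      ultimately show ?case
        unfolding prefixes_def by (metis imageI)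
    qed
  qed
  then have "card (prefixes R (same_past A m x)) = card ({m..<R} \<rightarrow>\<^sub>E A)"
    by (rule bij_betw_same_card)
  then show ?thesis
    by (simp add: card_PiE)
qed

text \<open>One radius serves both directions: that of \<open>T\<close> controls which part of the
  image is fixed by the past, that of \<open>T'\<close> how much of the preimage is determined by a
  prefix of the image.\<close>

locale automaton =
  fixes A :: "'a set" and T T' :: "(int \<Rightarrow> 'a) \<Rightarrow> int \<Rightarrow> 'a" and r :: int
  assumes finite_alphabet: "finite A"
    and closed: "x \<in> sequences A \<Longrightarrow> T x \<in> sequences A" "x \<in> sequences A \<Longrightarrow> T' x \<in> sequences A"
    and inverse: "x \<in> sequences A \<Longrightarrow> T' (T x) = x" "x \<in> sequences A \<Longrightarrow> T (T' x) = x"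
    and radius: "has_radius A r T" "has_radius A r T'"
    and shift_commutes: "x \<in> sequences A \<Longrightarrow> T (right_shift x) = right_shift (T x)"
    and r_nonneg: "0 \<le> r"
begin

text \<open>Below \<open>m\<close> the map \<open>T'\<close> reads only positions below
  \<open>m + r\<close>. Changing \<open>T x\<close> from \<open>R\<close> on therefore changes its
  preimage only from \<open>m\<close> on, where \<open>S\<close> allows every change.\<close>

lemma saturated_image:
  assumes S: "saturated A m S" "S \<subseteq> sequences A" and R: "R \<ge> m + r"
  shows "saturated A R (T ` S)"
  unfolding saturated_def
proof (intro ballI subsetI)
  fix y y' assume "y \<in> T ` S" and y': "y' \<in> same_past A R y"
  then obtain x where x: "x \<in> S" "y = T x" by blast
  have y'C: "y' \<in> sequences A" and y'R: "\<forall>i<R. y' i = y i" using y' by (auto simp: same_past_def)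
  have yC: "y \<in> sequences A" and xC: "x \<in> sequences A" using x S closed(1) by blast+
  have "T' y' i = T' y i" if "i < m" for i
    by (rule has_radiusD[OF radius(2) y'C yC]) (use y'R R that in auto)
  then have "T' y' \<in> same_past A m x"
    using closed(2)[OF y'C] x inverse(1)[OF xC] by (auto simp: same_past_def)
  then have "T' y' \<in> S" using S x by (auto simp: saturated_def)
  then show "y' \<in> T ` S" using inverse(2)[OF y'C] by (metis imageI)
qed

text \<open>Below \<open>m - r\<close> the image reads only the common past and is constant;
  finitely many positions remain below \<open>R\<close>.\<close>

lemma finite_prefixes_image:
  assumes x: "x \<in> sequences A"
  shows "finite (prefixes R (T ` same_past A m x))"
proof -
  define B where "B = (\<lambda>v. \<lambda>i\<in>{..<R}. if i < m - r then T x i else v i) ` ({m - r..<R} \<rightarrow>\<^sub>E A)"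
  have "prefixes R (T ` same_past A m x) \<subseteq> B"
  proof
    fix t assume "t \<in> prefixes R (T ` same_past A m x)"
    then obtain y where y: "y \<in> sequences A" "\<forall>i<m. y i = x i" "t = restrict (T y) {..<R}"
      by (auto simp: prefixes_def same_past_def)
    have "T y i = T x i" if "i < m - r" for i
      by (rule has_radiusD[OF radius(1) y(1) x]) (use y that in auto)
    then have "t = (\<lambda>i\<in>{..<R}. if i < m - r then T x i else restrict (T y) {m - r..<R} i)"
      using y(3) by (auto simp: fun_eq_iff)
    moreover have "restrict (T y) {m - r..<R} \<in> {m - r..<R} \<rightarrow>\<^sub>E A"
      using closed(1)[OF y(1)] by auto
    ultimately show "t \<in> B" unfolding B_def by blast
  qed
  moreover have "finite B"
    unfolding B_def by (intro finite_imageI finite_PiE) (auto simp: finite_alphabet)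
  ultimately show ?thesis by (rule finite_subset)
qed

lemma card_prefixes_image_shift:
  assumes x: "x \<in> sequences A"
  shows "card (prefixes (R + 1) (T ` same_past A (m + 1) (right_shift x)))
    = card (prefixes R (T ` same_past A m x))"
proof -
  have sp: "same_past A (m + 1) (right_shift x) = right_shift ` same_past A m x"
  proof (intro equalityI subsetI)
    fix y assume y: "y \<in> same_past A (m + 1) (right_shift x)"
    have "y i = y (i + 1 - 1)" for i by simp
    then have "y = right_shift (\<lambda>i. y (i + 1))" by (auto simp: right_shift_def)
    moreover have "(\<lambda>i. y (i + 1)) \<in> same_past A m x"
      using y by (auto simp: same_past_def right_shift_def)
    ultimately show "y \<in> right_shift ` same_past A m x" by blast
  qed (auto simp: same_past_def right_shift_def)
  have im: "T ` same_past A (m + 1) (right_shift x) = right_shift ` T ` same_past A m x"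
    unfolding sp image_image using shift_commutes by (intro image_cong) (auto simp: same_past_def)
  have pr: "prefixes (R + 1) (right_shift ` S) = right_shift ` prefixes R S" for S :: "(int \<Rightarrow> 'a) set"
    unfolding prefixes_def image_image
    by (intro image_cong) (auto simp: right_shift_def fun_eq_iff restrict_def)
  have "inj (right_shift :: (int \<Rightarrow> 'a) \<Rightarrow> _)"
  proof (rule injI)
    fix x y :: "int \<Rightarrow> 'a" assume "right_shift x = right_shift y"
    then have "right_shift x (i + 1) = right_shift y (i + 1)" for i by simp
    then show "x = y" by (auto simp: right_shift_def)
  qed
  then show ?thesis unfolding im pr by (intro card_image) (auto simp: inj_on_def)
qed

text \<open>Below \<open>m - r\<close> the image depends only on the past. From \<open>m - r\<close>
  on it reads only positions from \<open>m - 2 * r\<close> on, where replacing the past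
  \<open>x\<close> by \<open>x'\<close> is invisible. Overwriting the image below
  \<open>m - r\<close> by \<open>T x'\<close> is hence an injection between the prefix sets.\<close>

lemma card_prefixes_image_local:
  assumes x: "x \<in> sequences A" and x': "x' \<in> sequences A"
    and agree: "\<And>i. m - 2 * r \<le> i \<Longrightarrow> i < m \<Longrightarrow> x i = x' i"
  shows "card (prefixes R (T ` same_past A m x)) \<le> card (prefixes R (T ` same_past A m x'))"
proof (rule card_inj_on_le)
  let ?h = "\<lambda>t. \<lambda>i\<in>{..<R}. if i < m - r then T x' i else t i"
  have past: "T y i = T w i"
    if "y \<in> same_past A m w" "w \<in> sequences A" "i < m - r" for y w i
    by (rule has_radiusD[OF radius(1)]) (use that in \<open>auto simp: same_past_def\<close>)
  show "finite (prefixes R (T ` same_past A m x'))"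
    by (rule finite_prefixes_image[OF x'])
  show "inj_on ?h (prefixes R (T ` same_past A m x))"
  proof (rule inj_onI)
    fix s t assume s: "s \<in> prefixes R (T ` same_past A m x)" and t: "t \<in> prefixes R (T ` same_past A m x)"
      and eq: "?h s = ?h t"
    from s obtain y where y: "y \<in> same_past A m x" "s = restrict (T y) {..<R}"
      by (auto simp: prefixes_def)
    from t obtain y' where y': "y' \<in> same_past A m x" "t = restrict (T y') {..<R}"
      by (auto simp: prefixes_def)
    have "T y i = T y' i" if "i < R" for i
    proof (cases "i < m - r")
      case True then show ?thesis using past[OF y(1) x] past[OF y'(1) x] by simp
    next
      case False then show ?thesis using fun_cong[OF eq, of i] that y(2) y'(2) by simp
    qed
    then show "s = t" using y(2) y'(2) by (simp add: restrict_lessThan_eq_iff)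
  qed
  show "?h ` prefixes R (T ` same_past A m x) \<subseteq> prefixes R (T ` same_past A m x')"
  proof
    fix s assume "s \<in> ?h ` prefixes R (T ` same_past A m x)"
    then obtain y where y: "y \<in> same_past A m x" "s = ?h (restrict (T y) {..<R})"
      by (auto simp: prefixes_def)
    define y' where "y' = (\<lambda>i. if i < m then x' i else y i)"
    have yC: "y \<in> sequences A" using y by (simp add: same_past_def)
    have y'C: "y' \<in> sequences A" using yC x' by (auto simp: y'_def)
    have y'U: "y' \<in> same_past A m x'" using y'C by (auto simp: same_past_def y'_def)
    have "T y' i = T y i" if "i \<ge> m - r" for i
      by (rule has_radiusD[OF radius(1) y'C yC])
        (use that y(1) agree in \<open>auto simp: same_past_def y'_def\<close>)
    then have "s = restrict (T y') {..<R}"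
      using y(2) past[OF y'U x'] by (auto simp: fun_eq_iff)
    then show "s \<in> prefixes R (T ` same_past A m x')" using y'U by (auto simp: prefixes_def)
  qed
qed

text \<open>Through \<open>T'\<close> the prefix of \<open>T y\<close> below \<open>R\<close>
  determines \<open>y\<close> below \<open>m\<close>, so distinct classes of \<open>S\<close> have
  disjoint sets of image prefixes.\<close>

lemma card_prefixes_image_eq_sum:
  assumes S: "S \<subseteq> sequences A" "saturated A m S" and R: "R \<ge> m + r"
    and fin: "finite (prefixes m S)"
  shows "card (prefixes R (T ` S)) =
    (\<Sum>t\<in>prefixes m S. card (prefixes R (T ` {y \<in> S. restrict y {..<m} = t})))"
proof -
  let ?c = "\<lambda>t. {y \<in> S. restrict y {..<m} = t}"
  note cls = prefix_class_eq[OF S(2,1)]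
  have "prefixes R (T ` S) = (\<Union>t\<in>prefixes m S. prefixes R (T ` ?c t))"
    by (auto simp: prefixes_def)
  moreover have "card \<dots> = (\<Sum>t\<in>prefixes m S. card (prefixes R (T ` ?c t)))"
  proof (rule card_UN_disjoint)
    show "\<forall>t\<in>prefixes m S. finite (prefixes R (T ` ?c t))"
    proof
      fix t assume "t \<in> prefixes m S"
      then obtain y where "y \<in> S" "t = restrict y {..<m}" by (auto simp: prefixes_def)
      then show "finite (prefixes R (T ` ?c t))"
        using cls finite_prefixes_image S by auto
    qed
    show "\<forall>s\<in>prefixes m S. \<forall>t\<in>prefixes m S. s \<noteq> t \<longrightarrow>
        prefixes R (T ` ?c s) \<inter> prefixes R (T ` ?c t) = {}"
    proof (intro ballI impI, rule ccontr)
      fix s t assume "s \<noteq> t" "prefixes R (T ` ?c s) \<inter> prefixes R (T ` ?c t) \<noteq> {}"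
      then obtain y w where y: "y \<in> S" "restrict y {..<m} = s" and w: "w \<in> S" "restrict w {..<m} = t"
        and eq: "restrict (T y) {..<R} = restrict (T w) {..<R}"
        by (auto simp: prefixes_def)
      have C: "y \<in> sequences A" "w \<in> sequences A" using y w S by blast+
      have "T' (T y) i = T' (T w) i" if "i < m" for i
        by (rule has_radiusD[OF radius(2) closed(1)[OF C(1)] closed(1)[OF C(2)]])
          (use eq that R in \<open>auto simp: restrict_lessThan_eq_iff\<close>)
      then have "s = t" using y w inverse(1)[OF C(1)] inverse(1)[OF C(2)]
        by (auto simp: restrict_lessThan_eq_iff[symmetric])
      then show False using \<open>s \<noteq> t\<close> by simp
    qed
  qed (rule fin)
  ultimately show ?thesis by simp
qed

lemma saturated_same_past: "saturated A m (same_past A n x)" if "n \<le> m"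
  using that by (auto simp: saturated_def same_past_def)

lemma finite_prefixes_same_past:
  assumes "x \<in> sequences A" shows "finite (prefixes R (same_past A m x))"
proof -
  have "prefixes R (same_past A m x)
      \<subseteq> (\<lambda>v. \<lambda>i\<in>{..<R}. if i < m then x i else v i) ` ({m..<R} \<rightarrow>\<^sub>E A)"
  proof
    fix t assume "t \<in> prefixes R (same_past A m x)"
    then obtain y where y: "y \<in> same_past A m x" "t = restrict y {..<R}" by (auto simp: prefixes_def)
    then have "t = (\<lambda>i\<in>{..<R}. if i < m then x i else restrict y {m..<R} i)"
      by (auto simp: same_past_def fun_eq_iff)
    moreover have "restrict y {m..<R} \<in> {m..<R} \<rightarrow>\<^sub>E A" using y by (auto simp: same_past_def)
    ultimately show "t \<in> (\<lambda>v. \<lambda>i\<in>{..<R}. if i < m then x i else v i) ` ({m..<R} \<rightarrow>\<^sub>E A)" by blast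
  qed
  then show ?thesis by (rule finite_subset) (intro finite_imageI finite_PiE, auto simp: finite_alphabet)
qed

text \<open>Both classes are split by the prefix below \<open>m + 2 * r\<close>. Pieces with equal
  values from \<open>m\<close> on then satisfy the agreement hypothesis of
  \<open>card_prefixes_image_local\<close>; the further \<open>r\<close> in the bound on
  \<open>R\<close> is what the sum formula needs at that level.\<close>

lemma card_prefixes_image_le:
  assumes x: "x \<in> sequences A" and x': "x' \<in> sequences A" and R: "R \<ge> m + 3 * r"
  shows "card (prefixes R (T ` same_past A m x)) \<le> card (prefixes R (T ` same_past A m x'))"
proof -
  let ?k = "m + 2 * r"
  have kR: "R \<ge> ?k + r" using R by simp
  let ?U = "same_past A m x" and ?U' = "same_past A m x'"
  let ?c = "\<lambda>t. {y \<in> ?U. restrict y {..<?k} = t}" and ?c' = "\<lambda>t. {y \<in> ?U'. restrict y {..<?k} = t}"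
  let ?h = "\<lambda>t. \<lambda>i\<in>{..<?k}. if i < m then x' i else t i"
  have UC: "?U \<subseteq> sequences A" "?U' \<subseteq> sequences A" by (auto simp: same_past_def)
  have sat: "saturated A ?k ?U" "saturated A ?k ?U'"
    using r_nonneg by (auto intro: saturated_same_past)
  have fin: "finite (prefixes ?k ?U)" "finite (prefixes ?k ?U')"
    by (rule finite_prefixes_same_past[OF x], rule finite_prefixes_same_past[OF x'])
  have rep: "\<exists>y'. y' \<in> ?U' \<and> restrict y' {..<?k} = ?h (restrict y {..<?k}) \<and> (\<forall>i\<ge>m. y' i = y i)"
    if "y \<in> ?U" for y
  proof (intro exI conjI)
    let ?y = "\<lambda>i. if i < m then x' i else y i"
    show "?y \<in> ?U'" using that x' by (auto simp: same_past_def)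
    show "restrict ?y {..<?k} = ?h (restrict y {..<?k})" by (auto simp: fun_eq_iff)
  qed auto
  have "card (prefixes R (T ` ?U)) = (\<Sum>t\<in>prefixes ?k ?U. card (prefixes R (T ` ?c t)))"
    by (rule card_prefixes_image_eq_sum[OF UC(1) sat(1) kR fin(1)])
  also have "\<dots> \<le> (\<Sum>t\<in>prefixes ?k ?U. card (prefixes R (T ` ?c' (?h t))))"
  proof (rule sum_mono)
    fix t assume "t \<in> prefixes ?k ?U"
    then obtain y where y: "y \<in> ?U" "t = restrict y {..<?k}" by (auto simp: prefixes_def)
    obtain y' where y': "y' \<in> ?U'" "restrict y' {..<?k} = ?h t" "\<forall>i\<ge>m. y' i = y i"
      using rep[OF y(1)] y(2) by blast
    have "?c t = same_past A ?k y" "?c' (?h t) = same_past A ?k y'"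
      using prefix_class_eq[OF sat(1) UC(1) y(1)] prefix_class_eq[OF sat(2) UC(2) y'(1)] y(2) y'(2)
      by simp_all
    moreover have "y \<in> sequences A" "y' \<in> sequences A" using y y' UC by blast+
    then have "card (prefixes R (T ` same_past A ?k y)) \<le> card (prefixes R (T ` same_past A ?k y'))"
      using y'(3) by (intro card_prefixes_image_local) auto
    ultimately show "card (prefixes R (T ` ?c t)) \<le> card (prefixes R (T ` ?c' (?h t)))"
      by simp
  qed
  also have "\<dots> = (\<Sum>t\<in>?h ` prefixes ?k ?U. card (prefixes R (T ` ?c' t)))"
  proof (subst sum.reindex)
    show "inj_on ?h (prefixes ?k ?U)"
    proof (rule inj_onI)
      fix s t assume st: "s \<in> prefixes ?k ?U" "t \<in> prefixes ?k ?U" and eq: "?h s = ?h t"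
      show "s = t"
      proof
        fix i show "s i = t i"
          using st fun_cong[OF eq, of i] by (auto simp: prefixes_def same_past_def restrict_def split: if_splits)
      qed
    qed
  qed simp
  also have "\<dots> \<le> (\<Sum>t\<in>prefixes ?k ?U'. card (prefixes R (T ` ?c' t)))"
  proof (rule sum_mono2[OF fin(2)])
    show "?h ` prefixes ?k ?U \<subseteq> prefixes ?k ?U'"
    proof
      fix t assume "t \<in> ?h ` prefixes ?k ?U"
      then obtain y where "y \<in> ?U" "t = ?h (restrict y {..<?k})" by (auto simp: prefixes_def)
      then show "t \<in> prefixes ?k ?U'" using rep by (metis (mono_tags, lifting) imageI prefixes_def)
    qed
  qed simp
  also have "\<dots> = card (prefixes R (T ` ?U'))"
    by (rule card_prefixes_image_eq_sum[OF UC(2) sat(2) kR fin(2), symmetric])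
  finally show ?thesis .
qed

text \<open>The bound \<open>R - m \<ge> 3 * r\<close> makes the count independent of the past \<open>x\<close>, so that it
  behaves like a determinant: it is multiplicative along the powers of \<open>T\<close>.\<close>

lemma ex_card_prefixes_image:
  assumes R: "R \<ge> 3 * r"
  obtains K where "\<And>m x. x \<in> sequences A \<Longrightarrow> card (prefixes (m + R) (T ` same_past A m x)) = K"
proof (cases "sequences A = {}")
  case True then show ?thesis using that by blast
next
  case False
  then obtain x0 where x0: "x0 \<in> sequences A" by blast
  let ?N = "\<lambda>m x. card (prefixes (m + R) (T ` same_past A m x))"
  have eq: "?N m x = ?N m x'" if "x \<in> sequences A" "x' \<in> sequences A" for m x x'
    using card_prefixes_image_le[of x x' m "m + R"] card_prefixes_image_le[of x' x m "m + R"] that R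
    by (simp add: antisym)
  have step: "?N (m + 1) x0 = ?N m x0" for m
  proof -
    have "right_shift x0 \<in> sequences A" using x0 by (auto simp: right_shift_def)
    then have "?N (m + 1) x0 = ?N (m + 1) (right_shift x0)" by (intro eq[OF x0])
    also have "\<dots> = ?N m x0"
      using card_prefixes_image_shift[OF x0, of "m + R" m] by (simp add: algebra_simps)
    finally show ?thesis .
  qed
  have "?N m x0 = ?N 0 x0" for m
  proof (induction m rule: int_induct[of _ 0])
    case (step2 i) then show ?case using step[of "i - 1"] by simp
  qed (use step in auto)
  then show ?thesis using that[of "?N 0 x0"] eq[OF _ x0] by metis
qed

text \<open>Each application of \<open>T\<close> multiplies the number of prefixes by
  \<open>K\<close> while the threshold moves by \<open>R\<close>, whereas \<open>right_shift\<close>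
  turns a past below 0 into a past below 1. Comparing the two counts for \<open>T ^^ d\<close> gives
  \<open>card A * K ^ d = (card A ^ nat R) ^ d\<close>.\<close>

lemma root_of_shift:
  assumes d: "d \<ge> 1" and A: "A \<noteq> {}"
    and root: "\<And>x. x \<in> sequences A \<Longrightarrow> (T ^^ d) x = right_shift x"
  shows "\<exists>b. card A = b ^ d"
proof -
  \<comment> \<open>The added 1 keeps \<open>R\<close> positive when \<open>r = 0\<close>, so that
    the threshold \<open>d * R\<close> is at least 1.\<close>
  define R where "R = 3 * r + 1"
  have R: "R \<ge> 3 * r" "R \<ge> r" "R > 0" using r_nonneg by (auto simp: R_def)
  obtain K where K: "\<And>m x. x \<in> sequences A \<Longrightarrow> card (prefixes (m + R) (T ` same_past A m x)) = K"
    using ex_card_prefixes_image[OF R(1)] by blast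
  \<comment> \<open>Saturation is carried through the induction because it splits the image into
    full classes, each of which contributes \<open>K\<close>.\<close>
  have pow: "(T ^^ j) ` same_past A 0 x \<subseteq> sequences A \<and>
      saturated A (int j * R) ((T ^^ j) ` same_past A 0 x) \<and>
      finite (prefixes (int j * R) ((T ^^ j) ` same_past A 0 x)) \<and>
      card (prefixes (int j * R) ((T ^^ j) ` same_past A 0 x)) = K ^ j"
    if x: "x \<in> sequences A" for x j
  proof (induction j)
    case 0
    have "prefixes 0 (same_past A 0 x) = {restrict x {..<0}}"
      using x by (auto simp: prefixes_def same_past_def fun_eq_iff image_iff)
    then show ?case using saturated_same_past[of 0 0] by (auto simp: same_past_def)
  next
    case (Suc j)
    let ?m = "int j * R" and ?S = "(T ^^ j) ` same_past A 0 x"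
    have S: "?S \<subseteq> sequences A" "saturated A ?m ?S" "finite (prefixes ?m ?S)"
      "card (prefixes ?m ?S) = K ^ j" by (simp_all only: Suc)
    have m': "int (Suc j) * R = ?m + R" by (simp add: algebra_simps)
    have im: "(T ^^ Suc j) ` same_past A 0 x = T ` ?S" by (auto simp: image_comp)
    have cls: "\<exists>y\<in>sequences A. {y \<in> ?S. restrict y {..<?m} = t} = same_past A ?m y"
      if "t \<in> prefixes ?m ?S" for t
    proof -
      obtain y where y: "y \<in> ?S" "t = restrict y {..<?m}"
        using \<open>t \<in> prefixes ?m ?S\<close> by (rule prefixesE)
      show ?thesis
        using prefix_class_eq[OF S(2,1) y(1)] unfolding y(2)[symmetric]
        by (intro bexI[of _ y]) (use S(1) y(1) in \<open>simp_all only: subsetD\<close>)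
    qed
    have Kc: "card (prefixes (?m + R) (T ` {y \<in> ?S. restrict y {..<?m} = t})) = K"
      if "t \<in> prefixes ?m ?S" for t
    proof -
      obtain y where "y \<in> sequences A" "{y \<in> ?S. restrict y {..<?m} = t} = same_past A ?m y"
        using cls[OF \<open>t \<in> prefixes ?m ?S\<close>] by (elim bexE)
      then show ?thesis using K by simp
    qed
    have card: "card (prefixes (?m + R) (T ` ?S)) = K ^ Suc j"
    proof -
      have "card (prefixes (?m + R) (T ` ?S)) = (\<Sum>t\<in>prefixes ?m ?S. K)"
        by (subst card_prefixes_image_eq_sum[OF S(1,2) _ S(3)]) (use R(2) Kc in \<open>auto intro: sum.cong\<close>)
      then show ?thesis using S(4) by simp
    qed
    have "prefixes (?m + R) (T ` ?S)
        = (\<Union>t\<in>prefixes ?m ?S. prefixes (?m + R) (T ` {y \<in> ?S. restrict y {..<?m} = t}))"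
      by (auto simp: prefixes_def)
    moreover have "finite \<dots>"
    proof (rule finite_UN_I[OF S(3)])
      fix t assume "t \<in> prefixes ?m ?S"
      then obtain y where "y \<in> sequences A" "{y \<in> ?S. restrict y {..<?m} = t} = same_past A ?m y"
        using cls[of t] by blast
      then show "finite (prefixes (?m + R) (T ` {y \<in> ?S. restrict y {..<?m} = t}))"
        by (simp add: finite_prefixes_image)
    qed
    ultimately have "finite (prefixes (?m + R) (T ` ?S))" by simp
    moreover have "saturated A (?m + R) (T ` ?S)"
      by (rule saturated_image[OF S(2,1)]) (simp add: R(2))
    moreover have "T ` ?S \<subseteq> sequences A" using S(1) closed(1) by blast
    ultimately show ?case using card unfolding im m' by blast
  qed
  obtain a where "a \<in> A" using A by blast
  then have x: "(\<lambda>_. a) \<in> sequences A" by simp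
  have "(T ^^ d) ` same_past A 0 (\<lambda>_. a) = right_shift ` same_past A 0 (\<lambda>_. a)"
    using root by (intro image_cong) (auto simp: same_past_def)
  also have "\<dots> = same_past A 1 (\<lambda>_. a)"
  proof (intro equalityI subsetI)
    fix y assume y: "y \<in> same_past A 1 (\<lambda>_. a)"
    have "y = right_shift (\<lambda>i. y (i + 1))" by (auto simp: right_shift_def)
    moreover have "(\<lambda>i. y (i + 1)) \<in> same_past A 0 (\<lambda>_. a)" using y by (auto simp: same_past_def)
    ultimately show "y \<in> right_shift ` same_past A 0 (\<lambda>_. a)" by blast
  qed (auto simp: same_past_def right_shift_def)
  finally have "K ^ d = card (prefixes (int d * R) (same_past A 1 (\<lambda>_. a)))"
    using pow[OF x, of d] by simp
  also have dR: "1 \<le> int d * R" using d R(3) by (simp add: int_one_le_iff_zero_less)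
  then have "card (prefixes (int d * R) (same_past A 1 (\<lambda>_. a))) = card A ^ nat (int d * R - 1)"
    using card_prefixes_same_past[OF finite_alphabet x] by blast
  finally have "card A * K ^ d = card A ^ Suc (nat (int d * R - 1))" by simp
  also have "Suc (nat (int d * R - 1)) = nat R * d"
    using dR R(3) by (simp add: Suc_nat_eq_nat_zadd1 nat_mult_distrib mult.commute)
  finally have eq: "card A * K ^ d = (card A ^ nat R) ^ d" by (simp add: power_mult)
  \<comment> \<open>Divisibility of \<open>d\<close>-th powers passes to the bases. The quotient
    \<open>b\<close> is the reciprocal of the volume factor \<open>K / card A ^ R\<close>.\<close>
  then have "K ^ d dvd (card A ^ nat R) ^ d" by (metis dvd_triv_right)
  then have "K dvd card A ^ nat R" using d by simp
  then obtain b where b: "card A ^ nat R = K * b" by blast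
  have "card A > 0" using A finite_alphabet by (simp add: card_gt_0_iff)
  then have "K > 0" using b by (metis gr0I mult_is_0 power_eq_0_iff less_irrefl)
  then have "card A = b ^ d" using eq b by (simp add: power_mult_distrib)
  then show ?thesis by blast
qed

end

section \<open>Automorphisms and memory sets\<close>

text \<open>Comparing \<open>f x\<close> and \<open>f y\<close> at two different positions \<open>g\<close> and \<open>h\<close> builds equivariance into the
  notion of memory set.\<close>

definition memory_set ::
    "('g, 'm) monoid_scheme \<Rightarrow> 'a set \<Rightarrow> 'g set \<Rightarrow> (('g \<Rightarrow> 'a) \<Rightarrow> 'g \<Rightarrow> 'a) \<Rightarrow> bool" where
  "memory_set G A M f \<longleftrightarrow> finite M \<and> M \<subseteq> carrier G \<and>
    (\<forall>x\<in>carrier G \<rightarrow>\<^sub>E A. \<forall>y\<in>carrier G \<rightarrow>\<^sub>E A. \<forall>g\<in>carrier G. \<forall>h\<in>carrier G.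
      (\<forall>m\<in>M. x (g \<otimes>\<^bsub>G\<^esub> m) = y (h \<otimes>\<^bsub>G\<^esub> m)) \<longrightarrow> f x g = f y h)"

lemma memory_setD:
  assumes "memory_set G A M f" "x \<in> carrier G \<rightarrow>\<^sub>E A" "y \<in> carrier G \<rightarrow>\<^sub>E A"
    "g \<in> carrier G" "h \<in> carrier G"
    "\<And>m. m \<in> M \<Longrightarrow> x (g \<otimes>\<^bsub>G\<^esub> m) = y (h \<otimes>\<^bsub>G\<^esub> m)"
  shows "f x g = f y h"
  using assms unfolding memory_set_def by blast

section \<open>The correspondence between automorphisms and finite memory sets\<close>

context group begin

lemma shift_apply: "h \<in> carrier G \<Longrightarrow> shift G g x h = x (inv g \<otimes> h)"
  by (simp add: shift_def)

lemma shift_autsD: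
  assumes "f \<in> shift_auts G A"
  shows "f \<in> extensional (carrier G \<rightarrow>\<^sub>E A)" "bij_betw f (carrier G \<rightarrow>\<^sub>E A) (carrier G \<rightarrow>\<^sub>E A)"
    "x \<in> carrier G \<rightarrow>\<^sub>E A \<Longrightarrow> f x \<in> carrier G \<rightarrow>\<^sub>E A"
    "x \<in> carrier G \<rightarrow>\<^sub>E A \<Longrightarrow> g \<in> carrier G \<Longrightarrow> f (shift G g x) = shift G g (f x)"
  using assms Bij_imp_funcset[of f "carrier G \<rightarrow>\<^sub>E A"] by (auto simp: shift_auts_def Bij_def)

text \<open>One half of the Curtis-Hedlund-Lyndon theorem. By continuity \<open>f x \<one>\<close>
  is constant on a cylinder around each \<open>x\<close>, by compactness finitely many cylinders
  suffice, and the union of their supports is the memory set.\<close>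

lemma shift_auts_imp_memory_set:
  assumes f: "f \<in> shift_auts G A" and A: "finite A"
  shows "\<exists>M. memory_set G A M f"
proof -
  let ?S = "carrier G \<rightarrow>\<^sub>E A" and ?X = "full_shift G A"
  have "continuous_map ?X (discrete_topology A) (\<lambda>x. f x \<one>)"
  proof -
    have "continuous_map ?X ?X f"
      using f by (simp add: shift_auts_def homeomorphic_imp_continuous_map)
    moreover have "continuous_map ?X (discrete_topology A) (\<lambda>x. x \<one>)"
      unfolding full_shift_def by (rule continuous_map_product_projection) simp
    ultimately show ?thesis by (auto dest: continuous_map_compose simp: comp_def)
  qed
  then have op: "openin ?X {x \<in> ?S. f x \<one> \<in> U}" if "U \<subseteq> A" for U
    using that openin_continuous_map_preimage[of ?X "discrete_topology A" "\<lambda>x. f x \<one>" U] by simp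
  let ?cyl = "\<lambda>x M. {y \<in> ?S. \<forall>m\<in>M. y m = x m}"
  have "\<exists>M. finite M \<and> M \<subseteq> carrier G \<and> (\<forall>y\<in>?cyl x M. f y \<one> = f x \<one>)" if x: "x \<in> ?S" for x
  proof -
    let ?W = "{y \<in> ?S. f y \<one> \<in> {f x \<one>}}"
    have "f x \<one> \<in> A" using shift_autsD(3)[OF f x] by auto
    then have W: "openin ?X ?W" by (intro op) simp
    have "x \<in> ?W" using x by simp
    from bspec[OF W[unfolded full_shift_def openin_product_topology_alt topspace_discrete_topology] this]
    obtain U where U: "finite {i \<in> carrier G. U i \<noteq> A}" "x \<in> Pi\<^sub>E (carrier G) U" "Pi\<^sub>E (carrier G) U \<subseteq> ?W"
      by (elim exE conjE) (rule that)
    have "?cyl x {i \<in> carrier G. U i \<noteq> A} \<subseteq> Pi\<^sub>E (carrier G) U"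
    proof
      fix y assume y: "y \<in> ?cyl x {i \<in> carrier G. U i \<noteq> A}"
      have "y i \<in> U i" if "i \<in> carrier G" for i
        using y U(2) that by (cases "U i = A") (auto simp: PiE_iff)
      then show "y \<in> Pi\<^sub>E (carrier G) U" using y by (auto simp: PiE_iff)
    qed
    then have "\<forall>y\<in>?cyl x {i \<in> carrier G. U i \<noteq> A}. f y \<one> = f x \<one>" using U(3) by blast
    then show ?thesis using U(1) by blast
  qed
  then have "\<forall>x\<in>?S. \<exists>M. finite M \<and> M \<subseteq> carrier G \<and> (\<forall>y\<in>?cyl x M. f y \<one> = f x \<one>)"
    by (intro ballI)
  from bchoice[OF this] obtain N where
    N: "\<forall>x\<in>?S. finite (N x) \<and> N x \<subseteq> carrier G \<and> (\<forall>y\<in>?cyl x (N x). f y \<one> = f x \<one>)"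
    by (elim exE) (rule that)
  have cyl_open: "openin ?X (?cyl x (N x))" if x: "x \<in> ?S" for x
  proof -
    have NG: "finite (N x)" "N x \<subseteq> carrier G" using bspec[OF N x] by simp_all
    have "?cyl x (N x) = Pi\<^sub>E (carrier G) (\<lambda>i. if i \<in> N x then {x i} else A)"
      using x NG(2) by (auto simp: PiE_iff extensional_def subset_iff split: if_splits)
    moreover have "openin ?X \<dots>"
      unfolding full_shift_def
    proof (subst openin_PiE_gen, intro disjI2 conjI ballI)
      show "finite {i \<in> carrier G. (if i \<in> N x then {x i} else A) \<noteq> topspace (discrete_topology A)}"
        by (rule finite_subset[of _ "N x"]) (use NG in auto)
    qed (use x in auto)
    ultimately show ?thesis by simp
  qed
  have cpt: "compact_space ?X"
    unfolding full_shift_def using A by (simp add: compact_space_product_topology compact_space_discrete_topology)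
  have opens: "\<forall>U\<in>(\<lambda>x. ?cyl x (N x)) ` ?S. openin ?X U"
    by (intro ballI, elim imageE) (simp only: cyl_open)
  have cover: "topspace ?X \<subseteq> \<Union>((\<lambda>x. ?cyl x (N x)) ` ?S)"
  proof
    fix x assume "x \<in> topspace ?X"
    then show "x \<in> \<Union>((\<lambda>x. ?cyl x (N x)) ` ?S)" by (intro UN_I[of x]) simp_all
  qed
  from cpt[unfolded compact_space_alt, THEN spec, THEN mp, OF conjI[OF opens cover]]
  obtain \<F> where \<F>: "finite \<F>" "\<F> \<subseteq> (\<lambda>x. ?cyl x (N x)) ` ?S" "topspace ?X \<subseteq> \<Union>\<F>"
    by (elim exE conjE) (rule that)
  obtain P where P: "finite P" "P \<subseteq> ?S" "\<F> = (\<lambda>x. ?cyl x (N x)) ` P"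
    using \<F>(1,2) by (meson finite_subset_image)
  define M where "M = (\<Union>x\<in>P. N x)"
  have M: "finite M" "M \<subseteq> carrier G"
    unfolding M_def using P(1) bspec[OF N subsetD[OF P(2)]] by (simp_all add: UN_subset_iff)
  have one: "f x \<one> = f y \<one>" if x: "x \<in> ?S" and y: "y \<in> ?S" and xy: "\<And>m. m \<in> M \<Longrightarrow> x m = y m" for x y
  proof -
    obtain w where w: "w \<in> P" "x \<in> ?cyl w (N w)" using \<F>(3) P(3) x
      unfolding topspace_full_shift by (metis (no_types, lifting) UN_E subsetD)
    have "y m = w m" if "m \<in> N w" for m
      using that w xy[of m] unfolding M_def by fastforce
    then have "y \<in> ?cyl w (N w)" using y by simp
    then have "f y \<one> = f w \<one>" "f x \<one> = f w \<one>" using bspec[OF N subsetD[OF P(2) w(1)]] w(2) by simp_all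
    then show ?thesis by simp
  qed
  \<comment> \<open>Equivariance moves the evaluation at \<open>g\<close> to \<open>\<one>\<close>,
    which extends the memory set from \<open>\<one>\<close> to all pairs of positions.\<close>
  have at: "f x g = f (shift G (inv g) x) \<one>" if "x \<in> ?S" "g \<in> carrier G" for x g
    using that shift_autsD(4)[OF f] by (simp add: shift_apply)
  have eq: "f x g = f y h" if "x \<in> ?S" "y \<in> ?S" "g \<in> carrier G" "h \<in> carrier G"
    "\<forall>m\<in>M. x (g \<otimes> m) = y (h \<otimes> m)" for x y g h
    unfolding at[OF that(1,3)] at[OF that(2,4)]
    by (rule one) (use that M(2) in \<open>simp_all add: shift_in_full_shift shift_apply subset_iff\<close>)
  show ?thesis
    unfolding memory_set_def by (intro exI[of _ M] conjI M ballI impI) (rule eq)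
qed

text \<open>The other half. Every coordinate of \<open>f x\<close> depends on finitely many
  coordinates of \<open>x\<close>, hence \<open>f\<close> is continuous; the inverse is continuous
  because the full shift is compact and Hausdorff.\<close>

lemma memory_set_imp_shift_auts:
  assumes bij: "bij_betw f (carrier G \<rightarrow>\<^sub>E A) (carrier G \<rightarrow>\<^sub>E A)"
    and mem: "memory_set G A M f" and A: "finite A"
  shows "restrict f (carrier G \<rightarrow>\<^sub>E A) \<in> shift_auts G A"
proof -
  let ?S = "carrier G \<rightarrow>\<^sub>E A" and ?X = "full_shift G A"
  have fS: "f x \<in> ?S" if "x \<in> ?S" for x using bij that by (auto simp: bij_betw_def)
  have M: "finite M" "M \<subseteq> carrier G" using mem by (auto simp: memory_set_def)
  have cont: "continuous_map ?X ?X f"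
    unfolding full_shift_def
  proof (subst continuous_map_componentwise, intro conjI ballI)
    show "f ` topspace (product_topology (\<lambda>_. discrete_topology A) (carrier G)) \<subseteq> extensional (carrier G)"
      using fS by (auto simp: PiE_iff)
    fix g assume g: "g \<in> carrier G"
    show "continuous_map (product_topology (\<lambda>_. discrete_topology A) (carrier G)) (discrete_topology A) (\<lambda>x. f x g)"
      unfolding continuous_map_def
    proof (intro conjI allI impI)
      show "(\<lambda>x. f x g) \<in> topspace (product_topology (\<lambda>_. discrete_topology A) (carrier G)) \<rightarrow> topspace (discrete_topology A)"
        using fS g by (auto simp: PiE_iff)
      fix U assume "openin (discrete_topology A) U"
      show "openin (product_topology (\<lambda>_. discrete_topology A) (carrier G))
          {x \<in> topspace (product_topology (\<lambda>_. discrete_topology A) (carrier G)). f x g \<in> U}"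
        unfolding openin_product_topology_alt
      proof (intro ballI, goal_cases)
        case (1 x)
        then have x: "x \<in> ?S" "f x g \<in> U" by auto
        let ?V = "\<lambda>i. if i \<in> (\<lambda>m. g \<otimes> m) ` M then {x i} else A"
        have "finite {i \<in> carrier G. ?V i \<noteq> topspace (discrete_topology A)}"
          by (rule finite_subset[of _ "(\<lambda>m. g \<otimes> m) ` M"]) (use M in auto)
        moreover have VS: "Pi\<^sub>E (carrier G) ?V \<subseteq> ?S" using x(1) by (auto simp: PiE_iff split: if_splits)
        moreover have "f y g = f x g" if y: "y \<in> Pi\<^sub>E (carrier G) ?V" for y
        proof (rule memory_setD[OF mem _ x(1) g g])
          show "y \<in> ?S" using y x(1) by (auto simp: PiE_iff split: if_splits)
          fix m assume m: "m \<in> M"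
          then have "y (g \<otimes> m) \<in> ?V (g \<otimes> m)" using y g M(2) by (auto simp only: PiE_iff subset_iff m_closed)
          then show "y (g \<otimes> m) = x (g \<otimes> m)" using m by auto
        qed
        then have "Pi\<^sub>E (carrier G) ?V \<subseteq> {x \<in> ?S. f x g \<in> U}"
          using VS x(2) by (intro subsetI CollectI conjI) (simp_all only: subset_iff)
        moreover have "x \<in> Pi\<^sub>E (carrier G) ?V" using x(1) by (auto simp: PiE_iff)
        moreover have "\<forall>i\<in>carrier G. openin (discrete_topology A) (?V i)"
          using x(1) by (auto simp: PiE_iff)
        ultimately show ?case
          by (intro exI[of _ ?V] conjI) (simp_all only: topspace_product_topology topspace_discrete_topology)
      qed
    qed
  qed
  have "compact_space ?X" "Hausdorff_space ?X"
    unfolding full_shift_def using A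
    by (simp_all add: compact_space_product_topology compact_space_discrete_topology Hausdorff_space_product_topology)
  then have "homeomorphic_map ?X ?X f"
    using cont bij by (intro continuous_imp_homeomorphic_map) (auto simp: bij_betw_def)
  then have "homeomorphic_map ?X ?X (restrict f ?S)"
    by (rule homeomorphic_map_eq) simp
  moreover have "restrict f ?S \<in> Bij ?S"
    using bij bij_betw_cong[of ?S "restrict f ?S" f ?S] by (simp add: Bij_def)
  moreover have "f (shift G g x) = shift G g (f x)" if "g \<in> carrier G" "x \<in> ?S" for g x
  proof (rule PiE_ext)
    show "f (shift G g x) \<in> ?S" "shift G g (f x) \<in> ?S"
      using that by (simp_all add: fS shift_in_full_shift)
    fix h assume h: "h \<in> carrier G"
    have "f (shift G g x) h = f x (inv g \<otimes> h)"
    proof (rule memory_setD[OF mem])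
      show "shift G g x (h \<otimes> m) = x (inv g \<otimes> h \<otimes> m)" if "m \<in> M" for m
        using that M h \<open>g \<in> carrier G\<close> by (auto simp: shift_apply m_assoc subset_iff)
    qed (use that h in \<open>simp_all add: shift_in_full_shift\<close>)
    then show "f (shift G g x) h = shift G g (f x) h" using h by (simp add: shift_apply)
  qed
  ultimately show ?thesis
    by (simp add: shift_auts_def shift_in_full_shift)
qed

lemma carrier_shift_Aut: "carrier (shift_Aut G A) = shift_auts G A"
  by (simp add: shift_Aut_def)

lemma mult_shift_Aut:
  "f \<in> shift_auts G A \<Longrightarrow> f' \<in> shift_auts G A \<Longrightarrow>
    f \<otimes>\<^bsub>shift_Aut G A\<^esub> f' = compose (carrier G \<rightarrow>\<^sub>E A) f f'"
  by (simp add: shift_Aut_def BijGroup_def shift_auts_def)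

lemma pow_shift_Aut:
  assumes f: "f \<in> shift_auts G A" and x: "x \<in> carrier G \<rightarrow>\<^sub>E A"
  shows "(f [^]\<^bsub>shift_Aut G A\<^esub> (n::nat)) x = (f ^^ n) x"
  using x
proof (induction n arbitrary: x)
  case 0
  then show ?case by (simp add: shift_Aut_def BijGroup_def)
next
  case (Suc n)
  interpret H: group "shift_Aut G A" by (rule group_shift_Aut)
  have "f [^]\<^bsub>shift_Aut G A\<^esub> n \<in> shift_auts G A"
    using f H.nat_pow_closed by (simp add: carrier_shift_Aut)
  moreover have "f x \<in> carrier G \<rightarrow>\<^sub>E A" using shift_autsD(3)[OF f] Suc.prems by blast
  ultimately show ?case
    using Suc by (simp add: mult_shift_Aut f compose_eq funpow_swap1)
qed

text \<open>For central \<open>w\<close> the shifted value \<open>x (inv w \<otimes> g)\<close>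
  equals \<open>x (g \<otimes> inv w)\<close>, so \<open>{inv w}\<close> is a memory set.
  Commutation with an automorphism is the equivariance of the latter.\<close>

lemma central_shift_in_center:
  assumes w: "w \<in> group_center G" and A: "finite A"
  shows "restrict (shift G w) (carrier G \<rightarrow>\<^sub>E A) \<in> group_center (shift_Aut G A)"
proof -
  let ?S = "carrier G \<rightarrow>\<^sub>E A"
  have wG: "w \<in> carrier G" and cw: "\<And>g. g \<in> carrier G \<Longrightarrow> w \<otimes> g = g \<otimes> w"
    using w by (auto simp: group_center_def)
  have ciw: "inv w \<otimes> g = g \<otimes> inv w" if "g \<in> carrier G" for g
    using that wG cw[of "inv g"] by (metis inv_closed inv_inv inv_mult_group)
  have inverse: "shift G w (shift G (inv w) x) = x" "shift G (inv w) (shift G w x) = x" if "x \<in> ?S" for x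
    using that wG by (simp_all add: shift_mult[symmetric] shift_one)
  have closed: "shift G w x \<in> ?S" "shift G (inv w) x \<in> ?S" if "x \<in> ?S" for x
    using that wG by (simp_all add: shift_in_full_shift)
  have "restrict (shift G w) ?S \<in> shift_auts G A"
  proof (rule memory_set_imp_shift_auts[where M = "{inv w}"])
    show "bij_betw (shift G w) ?S ?S"
      by (rule bij_betw_byWitness[where f' = "shift G (inv w)"])
        (simp_all add: inverse closed image_subset_iff del: PiE_iff)
    show "memory_set G A {inv w} (shift G w)"
      using wG by (simp add: memory_set_def shift_apply ciw)
  qed (rule A)
  moreover have "compose ?S (restrict (shift G w) ?S) f = compose ?S f (restrict (shift G w) ?S)"
    if f: "f \<in> shift_auts G A" for f
    unfolding compose_def using shift_autsD(3,4)[OF f] wG closed(1)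
    by (intro restrict_ext) simp
  ultimately show ?thesis
    by (simp add: group_center_def carrier_shift_Aut mult_shift_Aut)
qed

end

section \<open>The centre of the automorphism group\<close>

text \<open>The powers of \<open>z\<close> are a central section of \<psi>: every element is
  uniquely a kernel element times a power of \<open>z\<close>. They serve as an axis along which
  patterns can be moved apart.\<close>

locale central_cyclic = group G for G (structure) +
  fixes \<psi> :: "'a \<Rightarrow> int" and z :: 'a
  assumes psi: "\<psi> \<in> hom G integer_group" and z_center: "z \<in> group_center G" and psi_z: "\<psi> z = 1"
begin

lemma z_closed [simp]: "z \<in> carrier G"
  using z_center by (simp add: group_center_def)

lemma psi_mult [simp]: "g \<in> carrier G \<Longrightarrow> h \<in> carrier G \<Longrightarrow> \<psi> (g \<otimes> h) = \<psi> g + \<psi> h"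
  using hom_mult[OF psi] by simp

lemma psi_one [simp]: "\<psi> \<one> = 0"
  using psi_mult[of \<one> \<one>] by simp

lemma psi_inv [simp]: "g \<in> carrier G \<Longrightarrow> \<psi> (inv g) = - \<psi> g"
  using psi_mult[of g "inv g"] by (simp add: eq_neg_iff_add_eq_0 del: psi_mult)

lemma psi_int_pow [simp]: "\<psi> (z [^] (i::int)) = i"
  using hom_int_pow[OF psi z_closed is_group group_integer_group, of i] psi_z by simp

lemma int_pow_commute:
  assumes g: "g \<in> carrier G"
  shows "z [^] (i::int) \<otimes> g = g \<otimes> z [^] i"
proof -
  have nat: "z [^] (n::nat) \<otimes> h = h \<otimes> z [^] n" if "h \<in> carrier G" for n h
    using that z_center by (intro group_commutes_pow) (auto simp: group_center_def)
  have inv: "inv (z [^] (n::nat)) \<otimes> g = g \<otimes> inv (z [^] n)" for n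
  proof -
    have "inv (inv g \<otimes> z [^] n) = inv (z [^] n \<otimes> inv g)"
      using nat[of "inv g"] g by simp
    then show ?thesis using g by (simp add: inv_mult_group)
  qed
  show ?thesis
    unfolding int_pow_def2 by (cases "i < 0") (simp_all only: if_True if_False nat[OF g] inv)
qed

end

section \<open>Marker automorphisms\<close>

definition occurs ::
    "('g, 'm) monoid_scheme \<Rightarrow> 'g set \<Rightarrow> ('g \<Rightarrow> 'a) \<Rightarrow> ('g \<Rightarrow> 'a) \<Rightarrow> 'g \<Rightarrow> bool" where
  "occurs G F p x g \<longleftrightarrow> (\<forall>s\<in>F. x (g \<otimes>\<^bsub>G\<^esub> s) = p s)"

text \<open>The pattern has a hole at the identity. A translate by \<open>e \<in> F\<close> would
  put the hole of one copy on the support of another; it clashes with the original at some common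
  position.\<close>

definition unbordered :: "('g, 'm) monoid_scheme \<Rightarrow> 'g set \<Rightarrow> ('g \<Rightarrow> 'a) \<Rightarrow> bool" where
  "unbordered G F p \<longleftrightarrow> finite F \<and> F \<subseteq> carrier G \<and> \<one>\<^bsub>G\<^esub> \<notin> F \<and>
    (\<forall>e\<in>F. \<exists>s\<in>F. e \<otimes>\<^bsub>G\<^esub> s \<in> F \<and> p (e \<otimes>\<^bsub>G\<^esub> s) \<noteq> p s)"

definition marker ::
    "('g, 'm) monoid_scheme \<Rightarrow> 'g set \<Rightarrow> ('g \<Rightarrow> 'a) \<Rightarrow> 'a \<Rightarrow> 'a \<Rightarrow> ('g \<Rightarrow> 'a) \<Rightarrow> 'g \<Rightarrow> 'a" where
  "marker G F p a b x =
    (\<lambda>g\<in>carrier G. if occurs G F p x g then (if x g = a then b else if x g = b then a else x g) else x g)"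

context group begin

lemma unbordered_not_occurs:
  assumes F: "unbordered G F p" and g: "g \<in> carrier G" and e: "e \<in> F" and occ: "occurs G F p x g"
  shows "\<not> occurs G F p x (g \<otimes> e)"
proof
  assume occ': "occurs G F p x (g \<otimes> e)"
  obtain s where s: "s \<in> F" "e \<otimes> s \<in> F" "p (e \<otimes> s) \<noteq> p s"
    using F e unfolding unbordered_def by blast
  have "s \<in> carrier G" "e \<in> carrier G" using F s e unfolding unbordered_def by blast+
  then have "g \<otimes> e \<otimes> s = g \<otimes> (e \<otimes> s)" using g by (simp add: m_assoc)
  moreover have "x (g \<otimes> e \<otimes> s) = p s" "x (g \<otimes> (e \<otimes> s)) = p (e \<otimes> s)"
    using occ occ' s unfolding occurs_def by blast+
  ultimately show False using s(3) by simp
qed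

lemma marker_closed:
  assumes "a \<in> A" "b \<in> A" "x \<in> carrier G \<rightarrow>\<^sub>E A"
  shows "marker G F p a b x \<in> carrier G \<rightarrow>\<^sub>E A"
  using assms by (auto simp: marker_def PiE_iff)

text \<open>The marker changes only holes of occurrences, and no such hole lies in the support of
  another occurrence, so occurrences are neither destroyed nor created.\<close>

lemma occurs_marker_iff:
  assumes F: "unbordered G F p" and g: "g \<in> carrier G"
  shows "occurs G F p (marker G F p a b x) g \<longleftrightarrow> occurs G F p x g"
proof -
  have FG: "s \<in> carrier G" if "s \<in> F" for s using F that unfolding unbordered_def by blast
  have eq: "marker G F p a b x (g \<otimes> s) = x (g \<otimes> s)"
    if "s \<in> F" "\<not> occurs G F p x (g \<otimes> s)" for s
    using that FG g by (simp add: marker_def)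
  show ?thesis
  proof
    assume occ: "occurs G F p x g"
    have "marker G F p a b x (g \<otimes> s) = p s" if s: "s \<in> F" for s
      using eq[OF s unbordered_not_occurs[OF F g s occ]] occ s by (simp add: occurs_def)
    then show "occurs G F p (marker G F p a b x) g" by (simp add: occurs_def)
  next
    assume occ: "occurs G F p (marker G F p a b x) g"
    show "occurs G F p x g"
    proof (rule ccontr)
      assume "\<not> occurs G F p x g"
      then obtain s where s: "s \<in> F" "x (g \<otimes> s) \<noteq> p s" by (auto simp: occurs_def)
      \<comment> \<open>The mismatch at \<open>g \<otimes> s\<close> was repaired by the marker, so
        the pattern occurs there in \<open>x\<close>. This occurrence survives, and the image then
        has two clashing occurrences.\<close>
      then have "occurs G F p x (g \<otimes> s)"
        using eq[OF s(1)] occ by (auto simp: occurs_def)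
      then have "marker G F p a b x (g \<otimes> s \<otimes> t) = x (g \<otimes> s \<otimes> t)" if "t \<in> F" for t
        using unbordered_not_occurs[OF F _ that, of "g \<otimes> s" x] that FG[OF that] FG[OF s(1)] g
        by (simp add: marker_def)
      then have "occurs G F p (marker G F p a b x) (g \<otimes> s)"
        using \<open>occurs G F p x (g \<otimes> s)\<close> by (simp add: occurs_def)
      then show False using unbordered_not_occurs[OF F g s(1) occ] by blast
    qed
  qed
qed

text \<open>Preservation of occurrences makes the marker an involution. The memory set contains
  \<open>\<one>\<close> for the symbol in the hole.\<close>

lemma marker_in_shift_auts:
  assumes F: "unbordered G F p" and A: "finite A" "a \<in> A" "b \<in> A"
  shows "restrict (marker G F p a b) (carrier G \<rightarrow>\<^sub>E A) \<in> shift_auts G A"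
proof (rule memory_set_imp_shift_auts[where M = "insert \<one> F"])
  have inv: "marker G F p a b (marker G F p a b x) = x" if "x \<in> carrier G \<rightarrow>\<^sub>E A" for x
  proof
    fix g show "marker G F p a b (marker G F p a b x) g = x g"
    proof (cases "g \<in> carrier G")
      case True
      let ?\<tau> = "\<lambda>c. if c = a then b else if c = b then a else c"
      have \<mu>: "marker G F p a b y g = (if occurs G F p y g then ?\<tau> (y g) else y g)" for y
        using True by (simp add: marker_def)
      show ?thesis
        by (simp only: \<mu>[of "marker G F p a b x"] occurs_marker_iff[OF F True] \<mu>[of x]) simp
    next
      case False
      then show ?thesis by (simp add: marker_def PiE_arb[OF that False])
    qed
  qed
  show "bij_betw (marker G F p a b) (carrier G \<rightarrow>\<^sub>E A) (carrier G \<rightarrow>\<^sub>E A)"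
    by (rule bij_betw_byWitness[where f' = "marker G F p a b"])
      (simp_all add: inv image_subset_iff marker_closed[OF A(2,3)])
  have FG: "F \<subseteq> carrier G" "finite F" using F by (auto simp: unbordered_def)
  show "memory_set G A (insert \<one> F) (marker G F p a b)"
    unfolding memory_set_def
  proof (intro conjI ballI impI)
    fix x y g h assume "x \<in> carrier G \<rightarrow>\<^sub>E A" "y \<in> carrier G \<rightarrow>\<^sub>E A"
      and g: "g \<in> carrier G" "h \<in> carrier G"
      and eq: "\<forall>m\<in>insert \<one> F. x (g \<otimes> m) = y (h \<otimes> m)"
    then show "marker G F p a b x g = marker G F p a b y h"
      by (simp add: marker_def occurs_def)
  qed (use FG in simp_all)
qed (rule A(1))

text \<open>A central automorphism \<open>f\<close> commutes with the marker automorphism. Flipping the hole of one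
  occurrence of \<open>p\<close> in \<open>x\<close> changes \<open>f x\<close>, so \<open>p\<close> also occurs in \<open>f x\<close>, within the memory set.\<close>

lemma central_occurrence:
  assumes F: "unbordered G F p" and A: "finite A" "a \<in> A" "b \<in> A" "a \<noteq> b"
    and p: "\<forall>g\<in>F. p g \<in> A"
    and f: "f \<in> group_center (shift_Aut G A)" and M: "memory_set G A M f"
  shows "\<exists>x\<in>carrier G \<rightarrow>\<^sub>E A. \<exists>m\<in>M. occurs G F p x \<one> \<and> occurs G F p (f x) (inv m)"
proof -
  let ?S = "carrier G \<rightarrow>\<^sub>E A" and ?\<mu> = "marker G F p a b"
  have FG: "F \<subseteq> carrier G" "\<one> \<notin> F" using F by (auto simp: unbordered_def)
  have MG: "M \<subseteq> carrier G" using M by (simp add: memory_set_def)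
  have fa: "f \<in> shift_auts G A" using f by (simp add: group_center_def carrier_shift_Aut)
  have fS: "f x \<in> ?S" if "x \<in> ?S" for x using shift_autsD(3)[OF fa that] .
  have \<mu>a: "restrict ?\<mu> ?S \<in> shift_auts G A" by (rule marker_in_shift_auts[OF F A(1-3)])
  then have "f \<otimes>\<^bsub>shift_Aut G A\<^esub> restrict ?\<mu> ?S = restrict ?\<mu> ?S \<otimes>\<^bsub>shift_Aut G A\<^esub> f"
    using f by (simp add: group_center_def carrier_shift_Aut)
  then have comp: "compose ?S f (restrict ?\<mu> ?S) = compose ?S (restrict ?\<mu> ?S) f"
    by (simp only: mult_shift_Aut fa \<mu>a)
  have comm: "f (?\<mu> x) = ?\<mu> (f x)" if "x \<in> ?S" for x
    using fun_cong[OF comp, of x] that fS[OF that] by (simp add: compose_eq)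
  define x where "x = (\<lambda>g\<in>carrier G. if g \<in> F then p g else a)"
  have xS: "x \<in> ?S" using p A(2) by (auto simp: x_def)
  have occ: "occurs G F p x \<one>" using FG by (auto simp: occurs_def x_def)
  have "x \<one> = a" "?\<mu> x \<one> = b" using occ FG(2) by (simp_all add: x_def marker_def)
  then have "?\<mu> x \<noteq> x" using A(4) by auto
  moreover have "inj_on f ?S" using shift_autsD(2)[OF fa] by (rule bij_betw_imp_inj_on)
  ultimately have "f (?\<mu> x) \<noteq> f x"
    using xS marker_closed[OF A(2,3) xS] by (simp add: inj_on_eq_iff)
  then obtain g where g: "f (?\<mu> x) g \<noteq> f x g" by blast
  have gG: "g \<in> carrier G"
    using g PiE_arb[OF fS[OF xS]] PiE_arb[OF fS[OF marker_closed[OF A(2,3) xS]]] by metis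
  have occ_f: "occurs G F p (f x) g"
    using g gG unfolding comm[OF xS] by (simp add: marker_def split: if_splits)
  obtain m where m: "m \<in> M" "?\<mu> x (g \<otimes> m) \<noteq> x (g \<otimes> m)"
    using g memory_setD[OF M marker_closed[OF A(2,3) xS] xS gG gG] by metis
  have mG: "m \<in> carrier G" using m MG by (simp add: subset_iff)
  have occ_m: "occurs G F p x (g \<otimes> m)"
    using m mG gG by (simp add: marker_def split: if_splits)
  \<comment> \<open>Recentring moves the occurrence at \<open>g \<otimes> m\<close> in
    \<open>x\<close> to \<open>\<one>\<close> and the occurrence at \<open>g\<close> in
    \<open>f x\<close> to \<open>inv m\<close>.\<close>
  let ?y = "shift G (inv (g \<otimes> m)) x"
  have y: "?y \<in> ?S" by (rule shift_in_full_shift[OF _ xS]) (simp add: mG gG)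
  have o1: "occurs G F p ?y \<one>"
    using occ_m FG mG gG by (simp add: occurs_def shift_apply subset_iff)
  have o2: "occurs G F p (f ?y) (inv m)"
  proof -
    have "f ?y (inv m \<otimes> s) = f x (g \<otimes> s)" if "s \<in> F" for s
    proof -
      have sG: "s \<in> carrier G" using that FG by (simp add: subset_iff)
      have "m \<otimes> (inv m \<otimes> s) = m \<otimes> inv m \<otimes> s" using mG sG by (intro m_assoc[symmetric]) simp_all
      then have "g \<otimes> m \<otimes> (inv m \<otimes> s) = g \<otimes> s"
        using mG gG sG by (simp add: m_assoc)
      then show ?thesis
        using sG mG gG by (simp add: shift_autsD(4)[OF fa xS] shift_apply)
    qed
    then show ?thesis using occ_f by (simp add: occurs_def)
  qed
  show ?thesis by (rule bexI[OF _ y], rule bexI[OF _ m(1)], rule conjI[OF o1 o2])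
qed

end

section \<open>Marker patterns built along the central direction\<close>

context central_cyclic begin

lemma ex_bound_psi:
  assumes "finite E" shows "\<exists>c\<ge>0. \<forall>g\<in>E. \<bar>\<psi> g\<bar> \<le> c"
proof (intro exI[of _ "\<Sum>g\<in>E. \<bar>\<psi> g\<bar>"] conjI ballI)
  show "\<bar>\<psi> g\<bar> \<le> (\<Sum>g\<in>E. \<bar>\<psi> g\<bar>)" if "g \<in> E" for g
    using assms that member_le_sum[of g E "\<lambda>g. \<bar>\<psi> g\<bar>"] by simp
qed (simp add: sum_nonneg)

text \<open>The background is \<open>a\<close>, except for a block of \<open>b\<close> near the lower end of the \<open>z\<close>-axis. The block
  is longer than \<open>E\<close>, so a translate of the pattern always puts some \<open>b\<close> of one copy against an \<open>a\<close>
  of the other.\<close>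

lemma ex_unbordered_extension:
  assumes E: "finite E" "E \<subseteq> carrier G" "\<one> \<notin> E" and r: "\<forall>g\<in>E. r g \<in> A"
    and ab: "a \<in> A" "b \<in> A" "a \<noteq> b"
  shows "\<exists>F p. unbordered G F p \<and> E \<subseteq> F \<and> (\<forall>g\<in>E. p g = r g) \<and> (\<forall>g\<in>F. p g \<in> A)"
proof -
  obtain c where c: "0 \<le> c" and cE: "\<And>g. g \<in> E \<Longrightarrow> \<bar>\<psi> g\<bar> \<le> c"
    using ex_bound_psi[OF E(1)] by blast
  define L where "L = 10 * c + 10"
  let ?\<kappa> = "\<lambda>g. g \<otimes> z [^] (- \<psi> g)"
  \<comment> \<open>\<open>K\<close> collects the kernel components of \<open>E\<close> and is
    closed under inversion, so that translations with a negative exponent can be reversed.\<close>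
  define K where "K = insert \<one> (?\<kappa> ` E \<union> (\<lambda>g. inv (?\<kappa> g)) ` E)"
  define F where "F = (\<lambda>(\<kappa>, j). \<kappa> \<otimes> z [^] j) ` (K \<times> {- L..L}) - {\<one>}"
  \<comment> \<open>Within \<open>F\<close> the block of \<open>b\<close> occupies the exponents
    from \<open>- 10 * c - 10\<close> to \<open>- 8 * c - 9\<close>, which are
    \<open>2 * c + 2\<close> heights, while \<open>E\<close> lies between the heights
    \<open>- c\<close> and \<open>c\<close>.\<close>
  define p where "p g = (if g \<in> E then r g else if g = z [^] \<psi> g \<and> \<psi> g < - 8 * c - 8 then b else a)" for g
  have zp: "z [^] (i::int) \<in> carrier G" for i by (rule int_pow_closed) simp
  have \<kappa>E: "?\<kappa> g \<in> carrier G" "\<psi> (?\<kappa> g) = 0" if "g \<in> E" for g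
    using subsetD[OF E(2) that] zp by simp_all
  have KG: "\<kappa> \<in> carrier G" and K0: "\<psi> \<kappa> = 0" and Kinv: "inv \<kappa> \<in> K" if \<kappa>: "\<kappa> \<in> K" for \<kappa>
  proof -
    consider "\<kappa> = \<one>" | g where "g \<in> E" "\<kappa> = ?\<kappa> g" | g where "g \<in> E" "\<kappa> = inv (?\<kappa> g)"
      using \<kappa> unfolding K_def by blast
    then have "\<kappa> \<in> carrier G \<and> \<psi> \<kappa> = 0 \<and> inv \<kappa> \<in> K"
    proof cases
      case 1 then show ?thesis by (simp add: K_def)
    next
      case 2 then show ?thesis unfolding K_def using \<kappa>E[OF 2(1)] by blast
    next
      case 3
      then have "inv \<kappa> = ?\<kappa> g" using \<kappa>E[OF 3(1)] by (simp only: inv_inv)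
      then show ?thesis unfolding K_def using 3 \<kappa>E[OF 3(1)] psi_inv[OF \<kappa>E(1)[OF 3(1)]] by simp
    qed
    then show "\<kappa> \<in> carrier G" "\<psi> \<kappa> = 0" "inv \<kappa> \<in> K" by blast+
  qed
  have inF: "\<kappa> \<otimes> z [^] i \<in> F" if "\<kappa> \<in> K" "\<bar>i\<bar> \<le> L" "i \<noteq> 0" for \<kappa> i
  proof -
    have "\<psi> (\<kappa> \<otimes> z [^] i) = i" using KG[OF that(1)] zp K0[OF that(1)] by simp
    then have "\<kappa> \<otimes> z [^] i \<noteq> \<one>" using that(3) by auto
    moreover have "(\<kappa>, i) \<in> K \<times> {- L..L}" using that by auto
    ultimately show ?thesis
      unfolding F_def by (intro DiffI image_eqI[where x = "(\<kappa>, i)"]) simp_all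
  qed
  have zF: "z [^] i \<in> F" if "\<bar>i\<bar> \<le> L" "i \<noteq> 0" for i
    using inF[of \<one> i] that zp by (simp add: K_def)
  have notE: "g \<notin> E" if "\<bar>\<psi> g\<bar> > c" for g using cE[of g] that by linarith
  have mismatch: "\<exists>i. z [^] i \<in> F \<and> \<kappa> \<otimes> z [^] (j + i) \<in> F \<and> p (\<kappa> \<otimes> z [^] (j + i)) \<noteq> p (z [^] i)"
    if \<kappa>: "\<kappa> \<in> K" and j: "0 \<le> j" "j \<le> L" and one: "\<kappa> = \<one> \<Longrightarrow> 1 \<le> j" for \<kappa> j
  proof -
    \<comment> \<open>The top of the block is tried first. If its translate lands at a height of
      \<open>E\<close>, where \<open>r\<close> prescribes the symbols, the bottom is taken: it is
      \<open>2 * c + 1\<close> lower and lands below \<open>- c\<close>. For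
      \<open>\<kappa> = \<one>\<close> the translate leaves the block because \<open>j\<close> is at
      least 1.\<close>
    define i where "i = (if \<bar>j - 8 * c - 9\<bar> \<le> c then - 10 * c - 10 else - 8 * c - 9)"
    have i: "i < - 8 * c - 8" "- L \<le> i" "\<bar>j + i\<bar> > c" "\<bar>j + i\<bar> \<le> L"
      using c j by (auto simp: i_def L_def)
    have ji: "\<kappa> = \<one> \<Longrightarrow> j + i \<ge> - 8 * c - 8"
      using c one by (auto simp: i_def)
    have ps: "\<psi> (\<kappa> \<otimes> z [^] (j + i)) = j + i" using KG[OF \<kappa>] zp K0[OF \<kappa>] by simp
    have "p (z [^] i) = b" using i c notE[of "z [^] i"] by (simp add: p_def)
    moreover have "p (\<kappa> \<otimes> z [^] (j + i)) = a"
    proof (cases "\<kappa> = \<one>")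
      case True
      then show ?thesis using notE[of "\<kappa> \<otimes> z [^] (j + i)"] ji ps i(3) by (simp add: p_def)
    next
      case False
      then have "\<kappa> \<otimes> z [^] (j + i) \<noteq> z [^] (j + i)"
        using KG[OF \<kappa>] zp r_cancel_one[of "z [^] (j + i)" \<kappa>] by simp
      then show ?thesis using notE[of "\<kappa> \<otimes> z [^] (j + i)"] ps i(3) by (simp add: p_def)
    qed
    moreover have "z [^] i \<in> F" using i c by (intro zF) (auto simp: L_def)
    moreover have "\<kappa> \<otimes> z [^] (j + i) \<in> F" using i c by (intro inF[OF \<kappa>]) auto
    ultimately show ?thesis using ab(3) by metis
  qed
  have "\<exists>s\<in>F. e \<otimes> s \<in> F \<and> p (e \<otimes> s) \<noteq> p s" if e: "e \<in> F" for e
  proof -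
    obtain \<kappa> j where \<kappa>: "\<kappa> \<in> K" "- L \<le> j" "j \<le> L" "e = \<kappa> \<otimes> z [^] j" "e \<noteq> \<one>"
      using e unfolding F_def by auto
    have \<kappa>G: "\<kappa> \<in> carrier G" using KG \<kappa>(1) .
    show ?thesis
    proof (cases "0 \<le> j")
      case True
      have "1 \<le> j" if "\<kappa> = \<one>"
        using that True \<kappa>(4,5) by (cases "j = 0") simp_all
      from mismatch[OF \<kappa>(1) True \<kappa>(3) this] obtain i where
        i: "z [^] i \<in> F" "\<kappa> \<otimes> z [^] (j + i) \<in> F" "p (\<kappa> \<otimes> z [^] (j + i)) \<noteq> p (z [^] i)"
        by blast
      moreover have "e \<otimes> z [^] i = \<kappa> \<otimes> z [^] (j + i)"
        unfolding \<kappa>(4) using \<kappa>G zp by (simp add: m_assoc int_pow_mult)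
      ultimately show ?thesis by (intro bexI[of _ "z [^] i"]) simp_all
    next
      \<comment> \<open>For negative \<open>j\<close> the two positions exchange roles:
        \<open>inv \<kappa>\<close> and \<open>- j\<close> give a mismatch, read from the other
        side.\<close>
      case False
      then obtain i where
        i: "z [^] i \<in> F" "inv \<kappa> \<otimes> z [^] (- j + i) \<in> F" "p (inv \<kappa> \<otimes> z [^] (- j + i)) \<noteq> p (z [^] i)"
        using mismatch[OF Kinv[OF \<kappa>(1)], of "- j"] \<kappa>(2) by auto
      have "e \<otimes> (inv \<kappa> \<otimes> z [^] (- j + i)) = \<kappa> \<otimes> (z [^] j \<otimes> inv \<kappa>) \<otimes> z [^] (- j + i)"
        unfolding \<kappa>(4) using \<kappa>G zp by (simp add: m_assoc)
      also have "\<dots> = \<kappa> \<otimes> (inv \<kappa> \<otimes> z [^] j) \<otimes> z [^] (- j + i)"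
        using \<kappa>G by (simp only: int_pow_commute[of "inv \<kappa>" j] inv_closed)
      also have "\<dots> = \<kappa> \<otimes> inv \<kappa> \<otimes> (z [^] j \<otimes> z [^] (- j + i))"
        using \<kappa>G zp by (simp only: m_assoc inv_closed m_closed)
      also have "\<dots> = z [^] i"
        using \<kappa>G zp by (simp flip: int_pow_mult)
      finally show ?thesis using i by (intro bexI[of _ "inv \<kappa> \<otimes> z [^] (- j + i)"]) simp_all
    qed
  qed
  moreover have "F \<subseteq> carrier G" using KG zp by (auto simp: F_def)
  moreover have "finite F" using E(1) by (simp add: F_def K_def)
  ultimately have "unbordered G F p" unfolding unbordered_def by (simp add: F_def)
  moreover have "E \<subseteq> F"
  proof
    fix g assume g: "g \<in> E"
    then have gG: "g \<in> carrier G" using E(2) by blast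
    have "g = ?\<kappa> g \<otimes> z [^] \<psi> g" using gG zp by (simp add: m_assoc flip: int_pow_mult)
    moreover have "(?\<kappa> g, \<psi> g) \<in> K \<times> {- L..L}"
      using g cE[OF g] c by (auto simp: K_def L_def)
    moreover have "g \<noteq> \<one>" using g E(3) by auto
    ultimately show "g \<in> F"
      unfolding F_def by (intro DiffI image_eqI[where x = "(?\<kappa> g, \<psi> g)"]) simp_all
  qed
  moreover have "\<forall>g\<in>E. p g = r g" "\<forall>g\<in>F. p g \<in> A" using r ab by (auto simp: p_def)
  ultimately show ?thesis by blast
qed

text \<open>The patterns are stored one after another at translates of \<open>M\<close>, each moved
  up by a power of \<open>z\<close> until it is clear of the earlier ones and of the hole. The
  exponent may be arbitrary, since a power of \<open>z\<close> commutes with everything.\<close>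

lemma ex_universal_pattern:
  assumes P: "finite P" "\<forall>(u, q)\<in>P. u \<in> carrier G \<and> (\<forall>g\<in>carrier G. q g \<in> A)"
    and M: "finite M" "M \<subseteq> carrier G"
  shows "\<exists>E r. finite E \<and> E \<subseteq> carrier G \<and> \<one> \<notin> E \<and> (\<forall>g\<in>E. r g \<in> A) \<and>
    (\<forall>(u, q)\<in>P. \<exists>j::int. \<forall>m\<in>M. u \<otimes> z [^] j \<otimes> m \<in> E \<and> r (u \<otimes> z [^] j \<otimes> m) = q m)"
  using P
proof (induction P rule: finite_induct)
  case empty
  show ?case by (intro exI[of _ "{}"]) simp
next
  case (insert uq P)
  obtain u q where uq: "uq = (u, q)" by (cases uq)
  have uG: "u \<in> carrier G" and qA: "\<And>g. g \<in> carrier G \<Longrightarrow> q g \<in> A"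
    using insert.prems uq by simp_all
  have "\<forall>(u, q)\<in>P. u \<in> carrier G \<and> (\<forall>g\<in>carrier G. q g \<in> A)"
    using insert.prems by simp
  from insert.IH[OF this] obtain E r where
    E: "finite E" "E \<subseteq> carrier G" "\<one> \<notin> E" "\<forall>g\<in>E. r g \<in> A" and
    Er': "\<forall>(u, q)\<in>P. \<exists>j::int. \<forall>m\<in>M. u \<otimes> z [^] j \<otimes> m \<in> E \<and> r (u \<otimes> z [^] j \<otimes> m) = q m"
    by (elim exE conjE) (rule that)
  have Er: "\<exists>j::int. \<forall>m\<in>M. u \<otimes> z [^] j \<otimes> m \<in> E \<and> r (u \<otimes> z [^] j \<otimes> m) = q m"
    if "(u, q) \<in> P" for u q
    using bspec[OF Er' that] by simp
  obtain c where c: "0 \<le> c" "\<forall>g\<in>E \<union> (\<lambda>m. u \<otimes> m) ` M. \<bar>\<psi> g\<bar> \<le> c"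
    using ex_bound_psi[of "E \<union> (\<lambda>m. u \<otimes> m) ` M"] E(1) M(1) by auto
  \<comment> \<open>The elements \<open>u \<otimes> m\<close> have height at least
    \<open>- c\<close>, so adding \<open>2 * c + 1\<close> lifts them above
    \<open>c\<close>.\<close>
  let ?v = "u \<otimes> z [^] (2 * c + 1)"
  have zp: "z [^] (i::int) \<in> carrier G" for i by (rule int_pow_closed) simp
  have vG: "?v \<in> carrier G" using uG zp by simp
  have large: "\<psi> (?v \<otimes> m) > c" if m: "m \<in> M" for m
  proof -
    have "m \<in> carrier G" using m M by blast
    then have "\<psi> (?v \<otimes> m) = \<psi> (u \<otimes> m) + (2 * c + 1)" using uG zp by simp
    moreover have "\<bar>\<psi> (u \<otimes> m)\<bar> \<le> c" using c(2) m by blast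
    ultimately show ?thesis by linarith
  qed
  have new: "?v \<otimes> m \<notin> E" "?v \<otimes> m \<noteq> \<one>" if m: "m \<in> M" for m
    using large[OF m] c by force+
  define r' where "r' g = (if g \<in> E then r g else q (inv ?v \<otimes> g))" for g
  have r'v: "r' (?v \<otimes> m) = q m" if m: "m \<in> M" for m
  proof -
    have "m \<in> carrier G" using m M by blast
    then have "inv ?v \<otimes> (?v \<otimes> m) = m" using vG by (simp only: m_assoc[symmetric] inv_closed l_inv l_one)
    then show ?thesis using new(1)[OF m] by (simp add: r'_def)
  qed
  let ?E = "E \<union> (\<lambda>m. ?v \<otimes> m) ` M"
  have sub: "(\<lambda>m. ?v \<otimes> m) ` M \<subseteq> carrier G" using vG M(2) by blast
  have one: "\<one> \<notin> (\<lambda>m. ?v \<otimes> m) ` M"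
  proof
    assume "\<one> \<in> (\<lambda>m. ?v \<otimes> m) ` M"
    then obtain m where "m \<in> M" "\<one> = ?v \<otimes> m" by (elim imageE)
    then show False using new(2) by metis
  qed
  have "finite ?E" "?E \<subseteq> carrier G" "\<one> \<notin> ?E"
    using E(1-3) M(1) sub one by simp_all
  moreover have "\<forall>g\<in>?E. r' g \<in> A"
  proof
    fix g assume "g \<in> ?E"
    then have "g \<in> carrier G" using E(2) sub by blast
    then show "r' g \<in> A" using E(4) qA vG by (simp add: r'_def)
  qed
  moreover have "\<exists>j::int. \<forall>m\<in>M. u' \<otimes> z [^] j \<otimes> m \<in> ?E \<and> r' (u' \<otimes> z [^] j \<otimes> m) = q' m"
    if "(u', q') \<in> insert uq P" for u' q'
  proof (cases "(u', q') = uq")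
    case True
    then have "u' = u" "q' = q" using uq by simp_all
    then show ?thesis using r'v by (intro exI[of _ "2 * c + 1"]) simp
  next
    case False
    then obtain j :: int where "\<forall>m\<in>M. u' \<otimes> z [^] j \<otimes> m \<in> E \<and> r (u' \<otimes> z [^] j \<otimes> m) = q' m"
      using Er \<open>(u', q') \<in> insert uq P\<close> by blast
    then show ?thesis by (intro exI[of _ j]) (simp add: r'_def)
  qed
  ultimately show ?case by (intro exI[of _ ?E] exI[of _ r'] conjI ballI) auto
qed

text \<open>The marker pattern contains every local pattern \<open>q\<close> next to every \<open>u \<in> U\<close>. An occurrence of it in \<open>x\<close>
  together with one at \<open>inv m\<close> in \<open>f x\<close> yields \<open>f q \<one> = q (inv u \<otimes> m \<otimes> u)\<close> for all of them, so \<open>m\<close>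
  commutes with \<open>U\<close>, which contains a witness against each non-central element of \<open>M\<close>.\<close>

lemma shift_Aut_center_subset:
  assumes A: "finite A" "a \<in> A" "b \<in> A" "a \<noteq> b" and f: "f \<in> group_center (shift_Aut G A)"
  shows "\<exists>w\<in>group_center G. f = restrict (shift G w) (carrier G \<rightarrow>\<^sub>E A)"
proof -
  let ?S = "carrier G \<rightarrow>\<^sub>E A"
  have fa: "f \<in> shift_auts G A" using f by (simp add: group_center_def carrier_shift_Aut)
  obtain M where M: "memory_set G A M f" using shift_auts_imp_memory_set[OF fa A(1)] by blast
  have MG: "finite M" "M \<subseteq> carrier G" using M by (simp_all add: memory_set_def)
  define w where "w m = (if m \<in> group_center G then \<one> else SOME u. u \<in> carrier G \<and> m \<otimes> u \<noteq> u \<otimes> m)" for m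
  have w: "w m \<in> carrier G" "m \<notin> group_center G \<Longrightarrow> m \<otimes> w m \<noteq> w m \<otimes> m" if m: "m \<in> M" for m
  proof -
    have "w m \<in> carrier G \<and> (m \<notin> group_center G \<longrightarrow> m \<otimes> w m \<noteq> w m \<otimes> m)"
    proof (cases "m \<in> group_center G")
      case False
      then have "\<exists>u. u \<in> carrier G \<and> m \<otimes> u \<noteq> u \<otimes> m"
        using subsetD[OF MG(2) m] by (auto simp: group_center_def)
      from someI_ex[OF this] show ?thesis using False by (simp add: w_def)
    qed (simp add: w_def)
    then show "w m \<in> carrier G" "m \<notin> group_center G \<Longrightarrow> m \<otimes> w m \<noteq> w m \<otimes> m" by simp_all
  qed
  define U where "U = insert \<one> (w ` M)"
  have U: "finite U" "U \<subseteq> carrier G" using MG(1) w(1) by (auto simp: U_def)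
  \<comment> \<open>The conjugates are included so that the stored patterns also record the values
    \<open>q (inv u \<otimes> m \<otimes> u)\<close>.\<close>
  define M' where "M' = M \<union> (\<lambda>(u, m). inv u \<otimes> m \<otimes> u) ` (U \<times> M)"
  have M': "finite M'" "M' \<subseteq> carrier G"
    using MG U by (auto simp: M'_def intro!: m_closed)
  \<comment> \<open>Truncation to \<open>M'\<close>, with default \<open>a\<close> elsewhere, leaves
    finitely many patterns to store.\<close>
  define trunc where "trunc q = (\<lambda>g\<in>carrier G. if g \<in> M' then q g else a)" for q
  have trunc_S: "trunc q \<in> ?S" if "q \<in> ?S" for q
    using PiE_mem[OF that] A(2) by (auto simp: trunc_def)
  have "trunc ` ?S \<subseteq> (\<lambda>v. \<lambda>g\<in>carrier G. if g \<in> M' then v g else a) ` (M' \<rightarrow>\<^sub>E A)"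
  proof
    fix t assume "t \<in> trunc ` ?S"
    then obtain q where q: "q \<in> ?S" "t = trunc q" by (elim imageE)
    have "restrict q M' \<in> M' \<rightarrow>\<^sub>E A" using PiE_mem[OF q(1)] M'(2) by (auto simp: subset_iff)
    moreover have "t = (\<lambda>g\<in>carrier G. if g \<in> M' then restrict q M' g else a)"
      by (auto simp: q(2) trunc_def fun_eq_iff)
    ultimately show "t \<in> (\<lambda>v. \<lambda>g\<in>carrier G. if g \<in> M' then v g else a) ` (M' \<rightarrow>\<^sub>E A)"
      by (intro image_eqI[where x = "restrict q M'"])
  qed
  moreover have "finite (M' \<rightarrow>\<^sub>E A)" by (rule finite_PiE[OF M'(1)]) (rule A(1))
  ultimately have "finite (trunc ` ?S)" by (rule finite_subset[OF _ finite_imageI])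
  then have fin: "finite (U \<times> trunc ` ?S)" by (rule finite_cartesian_product[OF U(1)])
  have pairs: "u \<in> carrier G \<and> (\<forall>g\<in>carrier G. q g \<in> A)" if uq: "(u, q) \<in> U \<times> trunc ` ?S" for u q
  proof -
    obtain q' where "q' \<in> ?S" "q = trunc q'" using SigmaD2[OF uq] by (elim imageE)
    then have "q \<in> ?S" using trunc_S by simp
    then show ?thesis using subsetD[OF U(2) SigmaD1[OF uq]] PiE_mem[of q "carrier G" "\<lambda>_. A"] by simp
  qed
  have PA: "\<forall>(u, q)\<in>U \<times> trunc ` ?S. u \<in> carrier G \<and> (\<forall>g\<in>carrier G. q g \<in> A)"
    by (intro ballI, unfold split_paired_all case_prod_conv) (rule pairs)
  from ex_universal_pattern[OF fin PA M'] obtain E r where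
    E: "finite E" "E \<subseteq> carrier G" "\<one> \<notin> E" "\<forall>g\<in>E. r g \<in> A" and
    univ: "\<forall>(u, q)\<in>U \<times> trunc ` ?S. \<exists>j::int. \<forall>m\<in>M'. u \<otimes> z [^] j \<otimes> m \<in> E \<and> r (u \<otimes> z [^] j \<otimes> m) = q m"
    by (elim exE conjE) (rule that)
  from ex_unbordered_extension[OF E(1-3) E(4) A(2-4)] obtain F p where
    F: "unbordered G F p" "E \<subseteq> F" "\<forall>g\<in>E. p g = r g" "\<forall>g\<in>F. p g \<in> A"
    by (elim exE conjE) (rule that)
  from central_occurrence[OF F(1) A F(4) f M] obtain x m where
    x: "x \<in> ?S" and m: "m \<in> M" and occ: "occurs G F p x \<one>" "occurs G F p (f x) (inv m)"
    by (elim bexE conjE) (rule that)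
  have FG: "F \<subseteq> carrier G" using F(1) by (simp add: unbordered_def)
  have mG: "m \<in> carrier G" using m MG(2) by (rule subsetD[rotated])
  have key: "f q \<one> = q (inv u \<otimes> m \<otimes> u)" if q: "q \<in> ?S" and u: "u \<in> U" for q u
  proof -
    have uG: "u \<in> carrier G" using u U(2) by (rule subsetD[rotated])
    have "(u, trunc q) \<in> U \<times> trunc ` ?S" using u q by simp
    from bspec[OF univ this] obtain j :: int where
      j: "\<And>n. n \<in> M' \<Longrightarrow> u \<otimes> z [^] j \<otimes> n \<in> E \<and> r (u \<otimes> z [^] j \<otimes> n) = trunc q n"
      by auto
    let ?v = "u \<otimes> z [^] j" and ?n = "inv u \<otimes> m \<otimes> u"
    have zG: "z [^] j \<in> carrier G" by (rule int_pow_closed) simp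
    have vG: "?v \<in> carrier G" using uG zG by simp
    have n: "?n \<in> M'" using u m by (force simp: M'_def)
    have nG: "?n \<in> carrier G" using uG mG by simp
    have tq: "trunc q n = q n" if "n \<in> M'" for n
      using that subsetD[OF M'(2) that] by (simp add: trunc_def)
    have vn: "?v \<otimes> ?n = m \<otimes> ?v"
    proof -
      have "?v \<otimes> ?n = u \<otimes> (z [^] j \<otimes> ?n)" using uG zG nG by (intro m_assoc)
      also have "\<dots> = u \<otimes> (?n \<otimes> z [^] j)" by (simp only: int_pow_commute[OF nG])
      also have "\<dots> = u \<otimes> inv u \<otimes> (m \<otimes> ?v)" using uG zG mG by (simp only: m_assoc m_closed inv_closed)
      also have "\<dots> = m \<otimes> ?v" using uG mG vG by simp
      finally show ?thesis .
    qed
    \<comment> \<open>Around \<open>?v\<close> the configuration \<open>x\<close> shows the stored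
      copy of \<open>q\<close>, at least on \<open>M\<close>.\<close>
    have "f q \<one> = f x ?v"
    proof (rule memory_setD[OF M q x one_closed vG])
      fix n assume nM: "n \<in> M"
      have nM': "n \<in> M'" using nM by (simp add: M'_def)
      have nG: "n \<in> carrier G" using nM' M'(2) by (rule subsetD[rotated])
      have vE: "?v \<otimes> n \<in> E" "r (?v \<otimes> n) = q n" using j[OF nM'] tq[OF nM'] by simp_all
      have "x (\<one> \<otimes> (?v \<otimes> n)) = p (?v \<otimes> n)"
        using occ(1) subsetD[OF F(2) vE(1)] by (simp add: occurs_def)
      then show "q (\<one> \<otimes> n) = x (?v \<otimes> n)"
        using bspec[OF F(3) vE(1)] vE(2) nG vG by simp
    qed
    \<comment> \<open>Because \<open>?v \<otimes> ?n = m \<otimes> ?v\<close>, the position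
      \<open>?v\<close> belongs to the occurrence of \<open>p\<close> at \<open>inv m\<close> in
      \<open>f x\<close>, and the symbol prescribed there is the stored \<open>q ?n\<close>.\<close>
    also have "?v = inv m \<otimes> (?v \<otimes> ?n)"
    proof -
      have "inv m \<otimes> (m \<otimes> ?v) = inv m \<otimes> m \<otimes> ?v" using mG vG by (intro m_assoc[symmetric]) simp_all
      then show ?thesis unfolding vn using mG vG by simp
    qed
    also have "f x (inv m \<otimes> (?v \<otimes> ?n)) = p (?v \<otimes> ?n)"
      using occ(2) j[OF n] subsetD[OF F(2)] by (simp add: occurs_def)
    also have "\<dots> = q ?n"
      using bspec[OF F(3)] j[OF n] tq[OF n] by simp
    finally show ?thesis .
  qed
  have f1: "f q \<one> = q m" if "q \<in> ?S" for q
    using key[OF that, of \<one>] mG by (simp add: U_def)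
  have conj_eq: "inv u \<otimes> m \<otimes> u = m" if u: "u \<in> U" for u
  proof (rule ccontr)
    assume ne: "inv u \<otimes> m \<otimes> u \<noteq> m"
    \<comment> \<open>This configuration separates \<open>m\<close> from its conjugate.\<close>
    let ?q = "\<lambda>g\<in>carrier G. if g = m then a else b"
    have q: "?q \<in> ?S" using A by simp
    have "u \<in> carrier G" using u U(2) by (rule subsetD[rotated])
    then have "?q (inv u \<otimes> m \<otimes> u) = b" using ne mG by simp
    moreover have "?q m = a" using mG by simp
    ultimately show False using key[OF q u] f1[OF q] A(4) by simp
  qed
  have mc: "m \<in> group_center G"
  proof (rule ccontr)
    assume nc: "m \<notin> group_center G"
    have wG: "w m \<in> carrier G" by (rule w(1)[OF m])
    have "inv (w m) \<otimes> m \<otimes> w m = m" using conj_eq m by (simp add: U_def)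
    then have "w m \<otimes> (inv (w m) \<otimes> (m \<otimes> w m)) = w m \<otimes> m"
      using wG mG by (simp only: m_assoc inv_closed m_closed)
    moreover have "w m \<otimes> (inv (w m) \<otimes> (m \<otimes> w m)) = w m \<otimes> inv (w m) \<otimes> (m \<otimes> w m)"
      using wG mG by (intro m_assoc[symmetric]) simp_all
    ultimately have "m \<otimes> w m = w m \<otimes> m" using wG mG by simp
    then show False using w(2)[OF m nc] by simp
  qed
  have comm: "m \<otimes> g = g \<otimes> m" if "g \<in> carrier G" for g
    using mc that by (simp add: group_center_def)
  have imc: "inv m \<in> group_center G"
  proof -
    have "inv m \<otimes> g = g \<otimes> inv m" if g: "g \<in> carrier G" for g
    proof -
      have "inv (m \<otimes> inv g) = inv (inv g \<otimes> m)" using comm[of "inv g"] g by simp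
      then show ?thesis using g mG by (simp add: inv_mult_group)
    qed
    then show ?thesis using mG by (simp add: group_center_def)
  qed
  have "f q = shift G (inv m) q" if q: "q \<in> ?S" for q
  proof (rule PiE_ext[OF shift_autsD(3)[OF fa q] shift_in_full_shift[OF _ q]])
    show "inv m \<in> carrier G" using mG by simp
    fix g assume g: "g \<in> carrier G"
    have s: "shift G (inv g) q \<in> ?S" by (rule shift_in_full_shift[OF _ q]) (simp add: g)
    have "f q g = f (shift G (inv g) q) \<one>"
      using shift_autsD(4)[OF fa q, of "inv g"] g by (simp add: shift_apply)
    also have "\<dots> = shift G (inv m) q g"
      using f1[OF s] g mG comm[OF g] by (simp add: shift_apply)
    finally show "f q g = shift G (inv m) q g" .
  qed
  then have "f = restrict (shift G (inv m)) ?S"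
    using shift_autsD(1)[OF fa] by (intro extensionalityI[of f ?S]) simp_all
  then show ?thesis using imc by blast
qed

end

section \<open>Roots of central shifts\<close>

text \<open>The root ranges over the whole group. Only the group structure is mentioned, so
  isomorphic groups share the property.\<close>

definition center_has_roots :: "('g, 'm) monoid_scheme \<Rightarrow> nat \<Rightarrow> bool" where
  "center_has_roots H d \<longleftrightarrow> (\<forall>c\<in>group_center H. \<exists>t\<in>carrier H. t [^]\<^bsub>H\<^esub> d = c)"

lemma center_has_roots_iso:
  assumes H: "group H" "group K" and iso: "H \<cong> K" and roots: "center_has_roots H d"
  shows "center_has_roots K d"
  unfolding center_has_roots_def
proof
  interpret H: group H by (rule H(1))
  obtain \<phi> where \<phi>: "\<phi> \<in> iso H K" using iso by (auto simp: is_iso_def)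
  then have hom: "\<phi> \<in> hom H K" and bij: "bij_betw \<phi> (carrier H) (carrier K)" by (auto simp: iso_def)
  fix c assume c: "c \<in> group_center K"
  then have "c \<in> \<phi> ` carrier H"
    using bij by (simp add: group_center_def bij_betw_def)
  then obtain c' where c': "c' \<in> carrier H" "\<phi> c' = c" by blast
  have "c' \<otimes>\<^bsub>H\<^esub> g = g \<otimes>\<^bsub>H\<^esub> c'" if g: "g \<in> carrier H" for g
  proof -
    have "\<phi> (c' \<otimes>\<^bsub>H\<^esub> g) = \<phi> (g \<otimes>\<^bsub>H\<^esub> c')"
      using c c' g hom_mult[OF hom] hom_in_carrier[OF hom g] by (auto simp: group_center_def)
    then show ?thesis
      using bij_betw_imp_inj_on[OF bij] c' g by (simp add: inj_on_eq_iff)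
  qed
  then have "c' \<in> group_center H" using c' by (simp add: group_center_def)
  then obtain t where t: "t \<in> carrier H" "t [^]\<^bsub>H\<^esub> d = c'"
    using roots by (auto simp: center_has_roots_def)
  have "\<phi> t [^]\<^bsub>K\<^esub> d = c"
    using hom_nat_pow[OF hom t(1) H, of d] t c' by simp
  then show "\<exists>t\<in>carrier K. t [^]\<^bsub>K\<^esub> d = c" using hom_in_carrier[OF hom t(1)] by blast
qed

context group begin

text \<open>The bijection \<open>e\<close> spells a symbol as \<open>d\<close> digits below
  \<open>b\<close>. The map \<open>T\<close> drops the first digit of each symbol and appends the
  first digit of the symbol at \<open>inv w \<otimes> g\<close>; after \<open>d\<close> steps the
  whole neighbouring symbol has arrived.\<close>

lemma central_shift_root:
  assumes A: "finite A" "card A = b ^ d" and d: "d > 0" and w: "w \<in> group_center G"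
  shows "\<exists>t\<in>carrier (shift_Aut G A). t [^]\<^bsub>shift_Aut G A\<^esub> d = restrict (shift G w) (carrier G \<rightarrow>\<^sub>E A)"
proof -
  let ?S = "carrier G \<rightarrow>\<^sub>E A" and ?D = "{..<d} \<rightarrow>\<^sub>E {..<b}"
  have "card ?D = card A" using A by (simp add: card_PiE)
  then obtain e where e: "bij_betw e A ?D"
    using finite_same_card_bij[OF A(1), of ?D] by (auto simp: finite_PiE)
  define e' where "e' = inv_into A e"
  have e'A: "e' v \<in> A" and ee': "e (e' v) = v" if "v \<in> ?D" for v
    using that bij_betw_inv_into_right[OF e] bij_betw_inv_into[OF e] unfolding e'_def bij_betw_def by auto
  have eD: "e c i \<in> {..<b}" if "c \<in> A" "i < d" for c i
    using bij_betwE[OF e] that PiE_mem[of "e c" "{..<d}" "\<lambda>_. {..<b}" i] by simp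
  have wG: "w \<in> carrier G" and cw: "\<And>g. g \<in> carrier G \<Longrightarrow> w \<otimes> g = g \<otimes> w"
    using w by (auto simp: group_center_def)
  have iwG: "inv w \<in> carrier G" using wG by simp
  have ciw: "g \<otimes> inv w = inv w \<otimes> g" if g: "g \<in> carrier G" for g
  proof -
    have "inv (inv g \<otimes> w) = inv (w \<otimes> inv g)" using cw[of "inv g"] g by simp
    then show ?thesis using g wG by (simp add: inv_mult_group)
  qed
  define T where "T x = (\<lambda>g\<in>carrier G. e' (\<lambda>i\<in>{..<d}. if Suc i < d then e (x g) (Suc i) else e (x (inv w \<otimes> g)) 0))" for x
  have TD: "(\<lambda>i\<in>{..<d}. if Suc i < d then e (x g) (Suc i) else e (x (inv w \<otimes> g)) 0) \<in> ?D"
    if x: "x \<in> ?S" and g: "g \<in> carrier G" for x g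
  proof -
    have "x g \<in> A" "x (inv w \<otimes> g) \<in> A" using PiE_mem[OF x] g iwG by simp_all
    then show ?thesis using eD d by (intro restrict_PiE_iff[THEN iffD2]) simp
  qed
  have TS: "T x \<in> ?S" if "x \<in> ?S" for x
    unfolding T_def using e'A[OF TD[OF that]] by (intro restrict_PiE_iff[THEN iffD2]) simp
  have eT: "e (T x g) i = (if Suc i < d then e (x g) (Suc i) else e (x (inv w \<otimes> g)) 0)"
    if "x \<in> ?S" "g \<in> carrier G" "i < d" for x g i
    using ee'[OF TD[OF that(1,2)]] that by (simp add: T_def)
  text \<open>Reading the digits of \<open>x\<close> along the coset of \<open>w\<close> as one sequence, \<open>T\<close> is the
    one-step shift and \<open>shift G w\<close> the shift by \<open>d\<close> steps.\<close>
  define y where "y x g n = e (x (inv w [^] (n div d) \<otimes> g)) (n mod d)" for x g and n :: nat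
  have yT: "y (T x) g n = y x g (Suc n)" if x: "x \<in> ?S" and g: "g \<in> carrier G" for x g n
  proof -
    let ?h = "inv w [^] (n div d) \<otimes> g"
    have h: "?h \<in> carrier G" using g iwG by simp
    have md: "n mod d < d" using d by simp
    have eq: "y (T x) g n = (if Suc (n mod d) < d then e (x ?h) (Suc (n mod d)) else e (x (inv w \<otimes> ?h)) 0)"
      using eT[OF x h md] by (simp add: y_def)
    show ?thesis
    proof (cases "Suc (n mod d) < d")
      case True
      then show ?thesis unfolding eq by (simp add: y_def mod_Suc div_Suc)
    next
      case False
      then have "Suc (n mod d) = d" using md by simp
      moreover have "inv w \<otimes> ?h = inv w [^] Suc (n div d) \<otimes> g"
        using nat_pow_Suc2[OF iwG, of "n div d"] g iwG by (simp add: m_assoc del: nat_pow_Suc)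
      ultimately show ?thesis unfolding eq by (simp add: y_def mod_Suc div_Suc del: nat_pow_Suc)
    qed
  qed
  have TpowS: "(T ^^ j) x \<in> ?S" if "x \<in> ?S" for j x
    using that by (induction j) (simp_all add: TS)
  have ypow: "y ((T ^^ j) x) g n = y x g (n + j)" if "x \<in> ?S" "g \<in> carrier G" for j x g n
    by (induction j arbitrary: n) (simp_all add: yT TpowS that)
  have Td: "(T ^^ d) x = shift G w x" if x: "x \<in> ?S" for x
  proof (rule PiE_ext[OF TpowS[OF x] shift_in_full_shift[OF wG x]])
    fix g assume g: "g \<in> carrier G"
    have mem: "(T ^^ d) x g \<in> A" "x (inv w \<otimes> g) \<in> A"
      using PiE_mem[OF TpowS[OF x] g] PiE_mem[OF x, of "inv w \<otimes> g"] g iwG by simp_all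
    have "e ((T ^^ d) x g) = e (x (inv w \<otimes> g))"
    proof (rule PiE_ext)
      show "e ((T ^^ d) x g) \<in> ?D" "e (x (inv w \<otimes> g)) \<in> ?D" using bij_betwE[OF e] mem by simp_all
      fix i assume "i \<in> {..<d}"
      then show "e ((T ^^ d) x g) i = e (x (inv w \<otimes> g)) i"
        using ypow[OF x g, of d i] d g iwG by (simp add: y_def)
    qed
    then show "(T ^^ d) x g = shift G w x g"
      using bij_betw_imp_inj_on[OF e] mem g by (simp add: shift_apply inj_on_eq_iff)
  qed
  have inverse: "shift G w (shift G (inv w) x) = x" "shift G (inv w) (shift G w x) = x" if "x \<in> ?S" for x
    using that wG by (simp_all add: shift_mult[symmetric] shift_one)
  obtain d' where d': "d = Suc d'" using d gr0_conv_Suc by blast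
  \<comment> \<open>Both injectivity and surjectivity are inherited from \<open>T ^^ d\<close>,
    which is the invertible shift by \<open>w\<close>.\<close>
  have "bij_betw T ?S ?S"
  proof (rule bij_betw_imageI)
    show "inj_on T ?S"
    proof (rule inj_onI)
      fix x y assume x: "x \<in> ?S" and y: "y \<in> ?S" and "T x = T y"
      then have "(T ^^ d) x = (T ^^ d) y" unfolding d' by (simp add: funpow_Suc_right del: funpow.simps)
      then have "shift G (inv w) (shift G w x) = shift G (inv w) (shift G w y)" using Td x y by simp
      then show "x = y" using inverse(2) x y by simp
    qed
    show "T ` ?S = ?S"
    proof (intro equalityI image_subsetI subsetI)
      fix x assume x: "x \<in> ?S"
      show "T x \<in> ?S" by (rule TS[OF x])
    next
      fix x assume x: "x \<in> ?S"
      let ?u = "shift G (inv w) x"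
      have u: "?u \<in> ?S" by (rule shift_in_full_shift[OF iwG x])
      have "x = T ((T ^^ d') ?u)" using Td[OF u] inverse(1)[OF x] by (simp add: d')
      then show "x \<in> T ` ?S" using TpowS[OF u] by (rule image_eqI)
    qed
  qed
  moreover have "memory_set G A {\<one>, inv w} T"
    unfolding memory_set_def using iwG by (simp add: T_def ciw cong: if_cong)
  ultimately have t: "restrict T ?S \<in> shift_auts G A"
    using A(1) by (rule memory_set_imp_shift_auts)
  interpret H: group "shift_Aut G A" by (rule group_shift_Aut)
  let ?t = "restrict T ?S [^]\<^bsub>shift_Aut G A\<^esub> d"
  have "?t \<in> shift_auts G A" using H.nat_pow_closed[of "restrict T ?S" d] t by (simp add: carrier_shift_Aut)
  moreover have "((restrict T ?S) ^^ j) x = (T ^^ j) x" if "x \<in> ?S" for x j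
    using that by (induction j) (simp_all add: TpowS)
  ultimately have "?t = restrict (shift G w) ?S"
    using shift_autsD(1) by (intro extensionalityI[of ?t ?S]) (simp_all add: pow_shift_Aut[OF t] Td)
  then show ?thesis using t by (auto simp: carrier_shift_Aut)
qed

end

section \<open>Transfer to integer sequences along \<psi>\<close>

context central_cyclic begin

text \<open>Identifies sequences with configurations constant on the fibres of \<psi>, turning
  \<open>right_shift\<close> into the shift by \<open>z\<close>.\<close>

definition inflate :: "(int \<Rightarrow> 'c) \<Rightarrow> 'a \<Rightarrow> 'c" where
  "inflate x = (\<lambda>g\<in>carrier G. x (\<psi> g))"

text \<open>The powers of \<open>z\<close> meet each fibre of \<psi> once, so reading along them
  inverts \<open>inflate\<close> on its image.\<close>

definition deflate :: "(('a \<Rightarrow> 'c) \<Rightarrow> 'a \<Rightarrow> 'c) \<Rightarrow> (int \<Rightarrow> 'c) \<Rightarrow> int \<Rightarrow> 'c" where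
  "deflate f x i = f (inflate x) (z [^] i)"

lemma z_pow_closed: "z [^] (i::int) \<in> carrier G"
  by (rule int_pow_closed) simp

lemma inflate_closed: "x \<in> sequences A \<Longrightarrow> inflate x \<in> carrier G \<rightarrow>\<^sub>E A"
  by (simp add: inflate_def)

lemma inflate_apply: "g \<in> carrier G \<Longrightarrow> inflate x g = x (\<psi> g)"
  by (simp add: inflate_def)

lemma inflate_z_pow: "inflate x (z [^] i) = x i"
  by (simp add: inflate_apply z_pow_closed)

lemma deflate_closed:
  assumes "f \<in> shift_auts G A" "x \<in> sequences A"
  shows "deflate f x \<in> sequences A"
  using PiE_mem[OF shift_autsD(3)[OF assms(1) inflate_closed[OF assms(2)]] z_pow_closed]
  by (simp add: deflate_def)

text \<open>An inflated configuration is fixed by the shifts by the kernel of \<open>\<psi>\<close>, hence so is its image.\<close>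

lemma inflate_deflate:
  assumes f: "f \<in> shift_auts G A" and x: "x \<in> sequences A"
  shows "inflate (deflate f x) = f (inflate x)"
proof (rule PiE_ext[OF inflate_closed[OF deflate_closed[OF f x]] shift_autsD(3)[OF f inflate_closed[OF x]]])
  fix g assume g: "g \<in> carrier G"
  \<comment> \<open>The kernel component of \<open>g\<close>; translation by its inverse carries
    \<open>g\<close> to a power of \<open>z\<close>.\<close>
  let ?k = "g \<otimes> z [^] (- \<psi> g)"
  have k: "?k \<in> carrier G" "\<psi> ?k = 0" using g z_pow_closed by simp_all
  have "shift G ?k (inflate x) = inflate x"
    using k by (simp add: shift_def inflate_def cong: restrict_cong)
  then have "f (inflate x) = shift G ?k (f (inflate x))"
    using shift_autsD(4)[OF f inflate_closed[OF x] k(1)] by simp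
  then have "f (inflate x) g = f (inflate x) (inv ?k \<otimes> g)"
    using g by (metis shift_apply)
  also have "inv ?k \<otimes> g = z [^] \<psi> g"
  proof -
    have "?k \<otimes> z [^] \<psi> g = g \<otimes> (z [^] (- \<psi> g) \<otimes> z [^] \<psi> g)" using g z_pow_closed by (intro m_assoc)
    also have "\<dots> = g" using g by (simp flip: int_pow_mult)
    finally show ?thesis using g k(1) z_pow_closed by (metis inv_solve_left)
  qed
  finally show "inflate (deflate f x) g = f (inflate x) g"
    using g by (simp add: inflate_apply deflate_def)
qed

lemma inflate_right_shift: "inflate (right_shift x) = shift G z (inflate x)"
  by (auto simp: inflate_def right_shift_def shift_def psi_z fun_eq_iff)

text \<open>A bound for \<psi> in absolute value on a memory set is a radius. Larger radii are
  included so that an automorphism and its inverse can share one.\<close>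

lemma ex_radius_deflate:
  assumes f: "f \<in> shift_auts G A" and A: "finite A"
  shows "\<exists>r\<ge>0. \<forall>r'\<ge>r. has_radius A r' (deflate f)"
proof -
  obtain M where M: "memory_set G A M f" using shift_auts_imp_memory_set[OF f A] by blast
  then have MG: "finite M" "M \<subseteq> carrier G" by (simp_all add: memory_set_def)
  obtain r where r: "r \<ge> 0" "\<forall>m\<in>M. \<bar>\<psi> m\<bar> \<le> r" using ex_bound_psi[OF MG(1)] by blast
  have "has_radius A r' (deflate f)" if r': "r' \<ge> r" for r'
    unfolding has_radius_def
  proof (intro ballI allI impI)
    fix x y i assume x: "x \<in> sequences A" and y: "y \<in> sequences A"
      and eq: "\<forall>j. \<bar>j - i\<bar> \<le> r' \<longrightarrow> x j = y j"
    show "deflate f x i = deflate f y i"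
      unfolding deflate_def
    proof (rule memory_setD[OF M inflate_closed[OF x] inflate_closed[OF y] z_pow_closed z_pow_closed])
      fix m assume m: "m \<in> M"
      have mG: "m \<in> carrier G" using m MG(2) by (rule subsetD[rotated])
      have "\<bar>i + \<psi> m - i\<bar> \<le> r'" using r(2) m r' by force
      then show "inflate x (z [^] i \<otimes> m) = inflate y (z [^] i \<otimes> m)"
        using eq mG z_pow_closed by (simp add: inflate_apply)
    qed
  qed
  then show ?thesis using r(1) by blast
qed

text \<open>Since \<open>inflate\<close> intertwines \<open>deflate t\<close> with \<open>t\<close>,
  the deflations of \<open>t\<close> and of its inverse form an \<open>automaton\<close> whose
  \<open>d\<close>-th power is the one-step shift, and \<open>root_of_shift\<close> applies.\<close>

lemma card_alphabet_power:
  assumes t: "t \<in> carrier (shift_Aut G A)" and A: "finite A" "A \<noteq> {}" and d: "d > 0"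
    and td: "t [^]\<^bsub>shift_Aut G A\<^esub> d = restrict (shift G z) (carrier G \<rightarrow>\<^sub>E A)"
  shows "\<exists>b. card A = b ^ d"
proof -
  let ?S = "carrier G \<rightarrow>\<^sub>E A" and ?H = "shift_Aut G A"
  interpret H: group ?H by (rule group_shift_Aut)
  have ta: "t \<in> shift_auts G A" using t by (simp add: carrier_shift_Aut)
  let ?t' = "inv\<^bsub>?H\<^esub> t"
  have t'a: "?t' \<in> shift_auts G A" using H.inv_closed[OF t] by (simp add: carrier_shift_Aut)
  have one: "\<one>\<^bsub>?H\<^esub> = restrict (\<lambda>x. x) ?S" by (simp add: shift_Aut_def BijGroup_def)
  have "compose ?S t ?t' = restrict (\<lambda>x. x) ?S" "compose ?S ?t' t = restrict (\<lambda>x. x) ?S"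
    using H.r_inv[OF t] H.l_inv[OF t] unfolding mult_shift_Aut[OF ta t'a] mult_shift_Aut[OF t'a ta] one by simp_all
  then have inverse: "t (?t' x) = x" "?t' (t x) = x" if "x \<in> ?S" for x
    using that by (metis compose_eq restrict_apply')+
  obtain r1 where r1: "r1 \<ge> 0" "\<forall>r'\<ge>r1. has_radius A r' (deflate t)"
    using ex_radius_deflate[OF ta A(1)] by blast
  obtain r2 where r2: "r2 \<ge> 0" "\<forall>r'\<ge>r2. has_radius A r' (deflate ?t')"
    using ex_radius_deflate[OF t'a A(1)] by blast
  interpret automaton A "deflate t" "deflate ?t'" "max r1 r2"
  proof
    show "finite A" by (rule A(1))
    show "deflate t x \<in> sequences A" if "x \<in> sequences A" for x by (rule deflate_closed[OF ta that])
    show "deflate ?t' x \<in> sequences A" if "x \<in> sequences A" for x by (rule deflate_closed[OF t'a that])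
    show "deflate ?t' (deflate t x) = x" if x: "x \<in> sequences A" for x
      unfolding deflate_def[of ?t'] inflate_deflate[OF ta x] inverse(2)[OF inflate_closed[OF x]]
      by (simp add: inflate_z_pow)
    show "deflate t (deflate ?t' x) = x" if x: "x \<in> sequences A" for x
      unfolding deflate_def[of t] inflate_deflate[OF t'a x] inverse(1)[OF inflate_closed[OF x]]
      by (simp add: inflate_z_pow)
    show "has_radius A (max r1 r2) (deflate t)" "has_radius A (max r1 r2) (deflate ?t')"
      using r1(2) r2(2) by simp_all
    show "0 \<le> max r1 r2" using r1(1) by simp
    show "deflate t (right_shift x) = right_shift (deflate t x)" if x: "x \<in> sequences A" for x
    proof
      fix i :: int
      have "inv z \<otimes> z [^] i = z [^] (i - 1)"
      proof -
        have "z \<otimes> z [^] (i - 1) = z [^] i"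
          using int_pow_mult[OF z_closed, of 1 "i - 1"] by simp
        then show ?thesis using z_pow_closed z_closed by (metis inv_solve_left)
      qed
      then show "deflate t (right_shift x) i = right_shift (deflate t x) i"
        using shift_autsD(4)[OF ta inflate_closed[OF x] z_closed]
        by (simp add: deflate_def inflate_right_shift right_shift_def[of "deflate t x"] shift_apply z_pow_closed)
    qed
  qed
  have pow: "(deflate t ^^ j) x \<in> sequences A \<and> inflate ((deflate t ^^ j) x) = (t ^^ j) (inflate x)"
    if "x \<in> sequences A" for j x
    using that
  proof (induction j)
    case (Suc j)
    then have *: "(deflate t ^^ j) x \<in> sequences A" by blast
    show ?case using Suc deflate_closed[OF ta *] inflate_deflate[OF ta *] by simp
  qed simp
  show ?thesis
  proof (rule root_of_shift)
    show "1 \<le> d" "A \<noteq> {}" using d A(2) by simp_all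
    fix x assume x: "x \<in> sequences A"
    have "(t ^^ d) (inflate x) = shift G z (inflate x)"
      using pow_shift_Aut[OF ta inflate_closed[OF x], of d] inflate_closed[OF x] by (simp add: td)
    then have "inflate ((deflate t ^^ d) x) = inflate (right_shift x)"
      using pow[OF x, of d] by (simp add: inflate_right_shift)
    then show "(deflate t ^^ d) x = right_shift x"
      by (intro ext) (metis inflate_z_pow)
  qed
qed

end

section \<open>Perfect powers\<close>

text \<open>Write \<open>n = m ^ r\<close> with \<open>r\<close> maximal. Then \<open>n ^ l\<close>,
  and hence \<open>n ^ k\<close>, is a power with exponent \<open>l * r\<close>. Cancelling common
  exponents shows that \<open>m\<close> is a power with exponent \<open>l' = l div gcd k l\<close>,
  and maximality of \<open>r\<close> forces \<open>l' = 1\<close>.\<close>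

lemma dvd_if_power_exponents:
  fixes n k l :: nat
  assumes n: "n \<ge> 2" and k: "k > 0" and l: "l > 0"
    and imp: "\<And>d b. d > 0 \<Longrightarrow> n ^ l = b ^ d \<Longrightarrow> \<exists>c. n ^ k = c ^ d"
  shows "l dvd k"
proof -
  define R where "R = {r. r > 0 \<and> (\<exists>m. n = m ^ r)}"
  have "r \<le> n" if "r \<in> R" for r
  proof -
    obtain m where m: "n = m ^ r" "r > 0" using \<open>r \<in> R\<close> by (auto simp: R_def)
    have "m \<ge> 2"
    proof (rule ccontr)
      assume "\<not> m \<ge> 2"
      then have "m = 0 \<or> m = 1" by auto
      then show False using m n by (auto simp: power_0_left)
    qed
    then have "2 ^ r \<le> n" using m(1) power_mono[of 2 m r] by simp
    then show "r \<le> n" using less_exp[of r] by linarith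
  qed
  then have fin: "finite R" by (meson finite_nat_set_iff_bounded_le)
  have "1 \<in> R" by (auto simp: R_def)
  define r where "r = Max R"
  have rR: "r \<in> R" using fin \<open>1 \<in> R\<close> unfolding r_def by (intro Max_in) auto
  then obtain m where m: "n = m ^ r" and r: "r > 0" by (auto simp: R_def)
  have "n ^ l = m ^ (l * r)" unfolding m by (simp add: mult.commute flip: power_mult)
  then obtain c where c: "n ^ k = c ^ (l * r)" using imp[of "l * r" m] l r by auto
  obtain g k' l' where g: "g = gcd k l" "k = g * k'" "l = g * l'" "coprime k' l'"
    using gcd_coprime_exists[of k l] k by (metis gcd_pos_nat mult.commute neq0_conv)
  have pos: "g > 0" "k' > 0" "l' > 0" using g k l by auto
  have "(m ^ k') ^ (g * r) = (c ^ l') ^ (g * r)"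
    using c unfolding m g(2,3) by (simp add: ac_simps flip: power_mult)
  then have mc: "m ^ k' = c ^ l'" using pos r by (simp add: power_eq_iff_eq_base)
  have m0: "m > 0" using m n r by (cases "m = 0") (simp_all add: power_0_left)
  \<comment> \<open>In \<open>m ^ k' = c ^ l'\<close> the exponents are coprime, so
    \<open>l'\<close> divides the multiplicity of every prime in \<open>m\<close>.\<close>
  have "is_nth_power l' m"
    unfolding is_nth_power_conv_multiplicity_nat[OF pos(3)]
  proof (intro allI impI)
    fix p :: nat assume p: "prime p"
    have c0: "c \<noteq> 0" using mc m0 pos by (metis power_eq_0_iff neq0_conv)
    have "k' * multiplicity p m = l' * multiplicity p c"
      using mc p m0 c0 by (metis prime_elem_multiplicity_power_distrib prime_imp_prime_elem neq0_conv)
    then have "l' dvd k' * multiplicity p m" by simp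
    then show "l' dvd multiplicity p m"
      using g(4) by (simp add: coprime_commute coprime_dvd_mult_right_iff)
  qed
  then obtain s where "m = s ^ l'" by (auto simp: is_nth_power_def)
  then have "l' * r \<in> R" using m pos r by (auto simp: R_def power_mult)
  then have "l' * r \<le> r" unfolding r_def using fin by (intro Max_ge)
  then have "l' = 1" using pos r by simp
  then show ?thesis using g by simp
qed

section \<open>Comparing the root exponents of the two automorphism groups\<close>

theorem theorem2:
  fixes G (structure) and \<psi> :: "'g \<Rightarrow> int" and n k l :: nat
  assumes "group G"
    and "infinite (carrier G)"
    and "\<psi> \<in> epi G integer_group"
    and "\<psi> ` group_center G = carrier integer_group"
    and "n \<ge> 2" and "k > 0" and "l > 0"
  shows "shift_Aut G {1..n ^ k} \<cong> shift_Aut G {1..n ^ l} \<longleftrightarrow> k = l"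
proof
  interpret group G by (rule assms(1))
  have "1 \<in> \<psi> ` group_center G" using assms(4) by simp
  then obtain z where z: "z \<in> group_center G" "\<psi> z = 1" by auto
  interpret central_cyclic G \<psi> z
    using assms(3) z by unfold_locales (simp_all add: epi_def)
  \<comment> \<open>A root of the single shift by \<open>z\<close> already makes the alphabet size a
    \<open>d\<close>-th power; the converse uses the description of the whole centre, for which 1
    and 2 are two distinct symbols.\<close>
  have roots_iff: "center_has_roots (shift_Aut G {1..n ^ j}) d \<longleftrightarrow> (\<exists>b. n ^ j = b ^ d)"
    if j: "j > 0" and d: "d > 0" for j d
  proof
    let ?A = "{1..n ^ j}"
    have two: "1 \<in> ?A" "2 \<in> ?A"
      using assms(5) j power_increasing[of 1 j n] by simp_all
    {
      assume "center_has_roots (shift_Aut G ?A) d"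
      then obtain t where "t \<in> carrier (shift_Aut G ?A)"
        "t [^]\<^bsub>shift_Aut G ?A\<^esub> d = restrict (shift G z) (carrier G \<rightarrow>\<^sub>E ?A)"
        using central_shift_in_center[OF z(1), of ?A] unfolding center_has_roots_def by blast
      then show "\<exists>b. n ^ j = b ^ d"
        using card_alphabet_power[of t ?A d] d two(1) by auto
    next
      assume "\<exists>b. n ^ j = b ^ d"
      then obtain b where b: "card ?A = b ^ d" by auto
      show "center_has_roots (shift_Aut G ?A) d"
        unfolding center_has_roots_def
      proof
        fix f assume "f \<in> group_center (shift_Aut G ?A)"
        then obtain w where w: "w \<in> group_center G" "f = restrict (shift G w) (carrier G \<rightarrow>\<^sub>E ?A)"
          using shift_Aut_center_subset[of ?A 1 2 f] two by auto
        show "\<exists>t\<in>carrier (shift_Aut G ?A). t [^]\<^bsub>shift_Aut G ?A\<^esub> d = f"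
          unfolding w(2) by (rule central_shift_root[OF _ b d w(1)]) simp
      qed
    }
  qed
  assume iso: "shift_Aut G {1..n ^ k} \<cong> shift_Aut G {1..n ^ l}"
  have same: "(\<exists>b. n ^ k = b ^ d) \<longleftrightarrow> (\<exists>b. n ^ l = b ^ d)" if d: "d > 0" for d
  proof -
    have "shift_Aut G {1..n ^ l} \<cong> shift_Aut G {1..n ^ k}"
      by (rule group.iso_sym[OF group_shift_Aut iso])
    then show ?thesis
      unfolding roots_iff[OF assms(6) d, symmetric] roots_iff[OF assms(7) d, symmetric]
      using center_has_roots_iso[OF group_shift_Aut group_shift_Aut] iso by blast
  qed
  have "l dvd k"
    by (rule dvd_if_power_exponents[OF assms(5-7)]) (use same in blast)
  moreover have "k dvd l"
    by (rule dvd_if_power_exponents[OF assms(5,7,6)]) (use same in blast)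
  ultimately show "k = l" by (intro dvd_antisym)
next
  assume "k = l"
  then show "shift_Aut G {1..n ^ k} \<cong> shift_Aut G {1..n ^ l}" by (simp add: iso_refl)
qed

end
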